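(* The following properties of a family $\mathcal{T}$ of bucket increasing trees (with maximal bucket size $b$, bucket-weights $(\psi_k)_{1\le k\le b-1}$ and degree-weights $(\varphi_k)_{k\ge0}$) are equivalent: (i) Combinatorial model: the family $\mathcal{T}$ can be modelled combinatorially by bucket-weights $\psi_k$ and degree-weights $\varphi_k$ as given for bucket recursive trees, $(b,d)$-ary increasing trees, or $(b,\alpha)$-plane oriented recursive trees, respectively (see context), up to scaling. (ii) Affine linear ratio: the total weights $T_n>0$ of trees of size $n$ of $\mathcal{T}$ satisfy for all $n\in\mathbb{N}$ \[ \frac{T_{n+1}}{T_n}=c_1\cdot n+c_2 \] with fixed real constants $c_1,c_2$. (iii) Tree evolution process: the family $\mathcal{T}$ is generated according to the tree evolution process of bucket recursive trees, $(b,d)$-ary increasing trees, or $(b,\alpha)$-plane oriented recursive trees, respectively (see context). (iv) Probabilistic growth rule: for every tree $T'$ of size $n$ with vertices $v_j$, $1\le j\le |V(T')|$, there exist probabilities $p_{T'}(v_j)$ such that, starting with a random tree $T'$ of size $n$, choosing a vertex $v_j$ in $T'$ according to the probabilities $p_{T'}(v_j)$ and attaching label $n+1$ to it, one obtains a random bucket increasing tree $T$ of size $n+1$. (v) Preservation of randomness: starting with a random tree $T\in\mathcal{T}$ of size $n\ge j$ and removing all labels larger than $j$, one obtains a random bucket increasing tree of size $j$ of the family $\mathcal{T}$. (vi) Balance: for a tree $T\in\mathcal{T}$ let $m_k=m_k(T)=|\{u\in T: c(u)=k<b\}|$ and $n_k=n_k(T)=|\{u\in T: c(u)=b \text{ and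 } \deg(u)=k\}|$. For all $T\in\mathcal{T}$ with $|T|=n$, \[ C_n=\sum_{k=1}^{b-1} m_k\frac{\psi_{k+1}}{\psi_k}+\sum_{k\ge0} n_k(k+1)\psi_1\frac{\varphi_{k+1}}{\varphi_k}, \] with $C_n$ independent of the particular tree $T$ (here $\psi_b:=\varphi_0$).
   Context: Fix a maximal bucket size $b\ge1$. A bucket ordered tree is a rooted ordered (plane) tree in which every node $v$ is a bucket with capacity $c(v)\in\{1,\dots,b\}$; all internal nodes are saturated ($c(v)=b$), leaves may be saturated or unsaturated. The size is $|T|=\sum_v c(v)$. An increasing labelling distributes the labels $1,\dots,|T|$ so that node $v$ holds $c(v)$ labels in increasing order and labels increase along every path from the root. Given nonnegative $(\varphi_k)_{k\ge0}$ with $\varphi_0>0$ (and some $\varphi_k>0$ for a $k\ge2$, excluding chains) and nonnegative $\psi_1,\dots,\psi_{b-1}$, a node has weight $w(v)=\varphi_{\deg(v)}$ if $c(v)=b$ ($\deg$ = out-degree) and $w(v)=\psi_{c(v)}$ if $c(v)<b$; $w(T)=\prod_v w(v)$. $T_n$ is the total weight of all increasingly labelled bucket ordered trees of size $n$, and a random tree of size $n$ is chosen with probability $w(T)/T_n$. Weight sequences are considered only up to scaling: for $a,s>0$, $\hat\varphi_k=a^b s^{k-1}\varphi_k$, $\hat\psi_k=a^k s^{-1}\psi_k$ give the same random tree distribution. Label $n+1$ is inserted into a tree of size $n$ either into an unsaturated node (increasing its capacity by one) or attached to a saturated node $v$ at one of its $\deg(v)+1$ positions as a new bucket of capacity $1$.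 The three families (each process starting from a single root bucket containing label 1; $p(v)$ = probability that node $v$ attracts label $n+1$ in a tree of size $n$): - Bucket recursive trees: $p(v)=c(v)/n$; weights $\varphi_k=(b-1)!\,b^k/k!$, $\psi_k=(k-1)!$. - $(b,d)$-ary increasing trees, $d\in\mathbb{Q}$ with $(d-1)b\in\mathbb{N}_0$: $p(v)=\frac{(d-1)c(v)+1-\deg(v)}{(d-1)n+1}$; weights $\varphi_k=(b-1)!(d-1)^{b-1}\binom{b-1+\frac1{d-1}}{b-1}\binom{b(d-1)+1}{k}$, $\psi_k=(k-1)!(d-1)^{k-1}\binom{k-1+\frac1{d-1}}{k-1}$. - $(b,\alpha)$-plane oriented recursive trees, $\alpha>0$: $p(v)=\frac{\deg(v)+(\alpha+1)c(v)-1}{(\alpha+1)n-1}$; weights $\varphi_k=(b-1)!(\alpha+1)^{b-1}\binom{b-1-\frac1{\alpha+1}}{b-1}\binom{(\alpha+1)b-2+k}{k}$, $\psi_k=(k-1)!(\alpha+1)^{k-1}\binom{k-1-\frac1{\alpha+1}}{k-1}$.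
   Formalization: Property (vi) additionally requires T_n > 0 for all n ≥ 1, and "T in the family" means positive weight; without this (vi) does not imply (i), e.g. b = 1, φ_0 = φ_2 = 1, all other weights 0, where every sum is 0. (iii)–(v) also state T_n > 0 so that the random trees exist. *)

theory Defs
  imports "HOL-Probability.Probability"
begin

text \<open>
  A vertex of a plane tree is the path leading to it from the root: the list of the positions of
  the successive children. Buckets are lists of labels, and the capacity of a node is the number
  of labels it holds.
\<close>

datatype btree = Node (bucket: "nat list") (children: "btree list")

primrec is_vertex :: "btree \<Rightarrow> nat list \<Rightarrow> bool" where
  "is_vertex T [] = True"
| "is_vertex T (i # v) = (i < length (children T) \<and> is_vertex (children T ! i) v)"

primrec subtree_at :: "btree \<Rightarrow> nat list \<Rightarrow> btree" where
  "subtree_at T [] = T"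
| "subtree_at T (i # v) = subtree_at (children T ! i) v"

primrec update_at :: "(btree \<Rightarrow> btree) \<Rightarrow> btree \<Rightarrow> nat list \<Rightarrow> btree" where
  "update_at f T [] = f T"
| "update_at f T (i # v) =
     Node (bucket T) ((children T)[i := update_at f (children T ! i) v])"

definition vertices :: "btree \<Rightarrow> nat list set" where
  "vertices T = {v. is_vertex T v}"

definition bucket_at :: "btree \<Rightarrow> nat list \<Rightarrow> nat list" where
  "bucket_at T v = bucket (subtree_at T v)"

definition capacity :: "btree \<Rightarrow> nat list \<Rightarrow> nat" where
  "capacity T v = length (bucket_at T v)"

definition outdeg :: "btree \<Rightarrow> nat list \<Rightarrow> nat" where
  "outdeg T v = length (children (subtree_at T v))"

definition tree_size :: "btree \<Rightarrow> nat" where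
  "tree_size T = (\<Sum>v\<in>vertices T. capacity T v)"

definition bucket_ordered :: "nat \<Rightarrow> btree \<Rightarrow> bool" where
  "bucket_ordered b T \<longleftrightarrow>
     (\<forall>v\<in>vertices T. capacity T v \<in> {1..b} \<and> (outdeg T v > 0 \<longrightarrow> capacity T v = b))"

definition increasingly_labelled :: "btree \<Rightarrow> bool" where
  "increasingly_labelled T \<longleftrightarrow>
     disjoint_family_on (\<lambda>v. set (bucket_at T v)) (vertices T) \<and>
     (\<Union>v\<in>vertices T. set (bucket_at T v)) = {1..tree_size T} \<and>
     (\<forall>v\<in>vertices T. sorted_wrt (<) (bucket_at T v)) \<and>
     (\<forall>v i. v @ [i] \<in> vertices T \<longrightarrow>
        (\<forall>x\<in>set (bucket_at T v). \<forall>y\<in>set (bucket_at T (v @ [i])). x < y))"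

definition bucket_trees :: "nat \<Rightarrow> nat \<Rightarrow> btree set" where
  "bucket_trees b n =
     {T. bucket_ordered b T \<and> increasingly_labelled T \<and> tree_size T = n}"


subsection \<open>Weights and random trees\<close>

definition node_weight ::
  "nat \<Rightarrow> (nat \<Rightarrow> real) \<Rightarrow> (nat \<Rightarrow> real) \<Rightarrow> btree \<Rightarrow> nat list \<Rightarrow> real" where
  "node_weight b \<phi> \<psi> T v =
     (if capacity T v = b then \<phi> (outdeg T v) else \<psi> (capacity T v))"

definition tree_weight ::
  "nat \<Rightarrow> (nat \<Rightarrow> real) \<Rightarrow> (nat \<Rightarrow> real) \<Rightarrow> btree \<Rightarrow> real" where
  "tree_weight b \<phi> \<psi> T = (\<Prod>v\<in>vertices T. node_weight b \<phi> \<psi> T v)"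

definition total_weight ::
  "nat \<Rightarrow> (nat \<Rightarrow> real) \<Rightarrow> (nat \<Rightarrow> real) \<Rightarrow> nat \<Rightarrow> real" where
  "total_weight b \<phi> \<psi> n = (\<Sum>T\<in>bucket_trees b n. tree_weight b \<phi> \<psi> T)"

text \<open>The random tree of size \<open>n\<close> exists precisely when the total weight is positive;
  otherwise the following distribution is unspecified.\<close>

definition random_tree ::
  "nat \<Rightarrow> (nat \<Rightarrow> real) \<Rightarrow> (nat \<Rightarrow> real) \<Rightarrow> nat \<Rightarrow> btree pmf" where
  "random_tree b \<phi> \<psi> n =
     embed_pmf (\<lambda>T. if T \<in> bucket_trees b n
                    then tree_weight b \<phi> \<psi> T / total_weight b \<phi> \<psi> n else 0)"

definition all_sizes ::
  "nat \<Rightarrow> (nat \<Rightarrow> real) \<Rightarrow> (nat \<Rightarrow> real) \<Rightarrow> bool" where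
  "all_sizes b \<phi> \<psi> \<longleftrightarrow> (\<forall>n\<ge>1. total_weight b \<phi> \<psi> n > 0)"

text \<open>The trees of the family are those of positive weight.\<close>

definition family ::
  "nat \<Rightarrow> (nat \<Rightarrow> real) \<Rightarrow> (nat \<Rightarrow> real) \<Rightarrow> nat \<Rightarrow> btree set" where
  "family b \<phi> \<psi> n = {T \<in> bucket_trees b n. tree_weight b \<phi> \<psi> T > 0}"


subsection \<open>Inserting and removing labels\<close>

text \<open>When a label is attached to a saturated node, the position of the new bucket is uniform
  among the available ones.\<close>

definition attach :: "nat \<Rightarrow> nat \<Rightarrow> btree \<Rightarrow> nat list \<Rightarrow> btree pmf" where
  "attach b x T v =
     (if capacity T v < b
      then return_pmf (update_at (\<lambda>t. Node (bucket t @ [x]) (children t)) T v)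
      else map_pmf
        (\<lambda>i. update_at (\<lambda>t. Node (bucket t)
                (take i (children t) @ Node [x] [] # drop i (children t))) T v)
        (pmf_of_set {0..outdeg T v}))"

text \<open>Nodes losing all their labels disappear; in an increasingly labelled tree all their
  descendants lose all their labels as well.\<close>

primrec remove_above :: "nat \<Rightarrow> btree \<Rightarrow> btree" where
  "remove_above j (Node ls ts) =
     Node (filter (\<lambda>x. x \<le> j) ls) (filter (\<lambda>t. bucket t \<noteq> []) (map (remove_above j) ts))"


subsection \<open>The three special families\<close>

datatype model = Bucket_Recursive | Ary real | Plane_Oriented real

primrec admissible :: "nat \<Rightarrow> model \<Rightarrow> bool" where
  "admissible b Bucket_Recursive = True"
| "admissible b (Ary d) = (d \<in> \<rat> \<and> (d - 1) * real b \<in> \<nat>)"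
| "admissible b (Plane_Oriented \<alpha>) = (\<alpha> > 0)"

text \<open>The value \<open>d = 1\<close> yields chains. There \<open>1 / (d - 1)\<close> is to be read as a limit; the totalized
  division below instead gives the zero sequence for \<open>b \<ge> 2\<close> and the chain weights for \<open>b = 1\<close>.\<close>

primrec model_phi :: "nat \<Rightarrow> model \<Rightarrow> nat \<Rightarrow> real" where
  "model_phi b Bucket_Recursive k = fact (b - 1) * real b ^ k / fact k"
| "model_phi b (Ary d) k =
     fact (b - 1) * (d - 1) ^ (b - 1) * ((real (b - 1) + 1 / (d - 1)) gchoose (b - 1)) *
     ((real b * (d - 1) + 1) gchoose k)"
| "model_phi b (Plane_Oriented \<alpha>) k =
     fact (b - 1) * (\<alpha> + 1) ^ (b - 1) * ((real (b - 1) - 1 / (\<alpha> + 1)) gchoose (b - 1)) *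
     (((\<alpha> + 1) * real b - 2 + real k) gchoose k)"

primrec model_psi :: "model \<Rightarrow> nat \<Rightarrow> real" where
  "model_psi Bucket_Recursive k = fact (k - 1)"
| "model_psi (Ary d) k =
     fact (k - 1) * (d - 1) ^ (k - 1) * ((real (k - 1) + 1 / (d - 1)) gchoose (k - 1))"
| "model_psi (Plane_Oriented \<alpha>) k =
     fact (k - 1) * (\<alpha> + 1) ^ (k - 1) * ((real (k - 1) - 1 / (\<alpha> + 1)) gchoose (k - 1))"

primrec attraction :: "model \<Rightarrow> nat \<Rightarrow> btree \<Rightarrow> nat list \<Rightarrow> real" where
  "attraction Bucket_Recursive n T v = real (capacity T v) / real n"
| "attraction (Ary d) n T v =
     ((d - 1) * real (capacity T v) + 1 - real (outdeg T v)) / ((d - 1) * real n + 1)"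
| "attraction (Plane_Oriented \<alpha>) n T v =
     (real (outdeg T v) + (\<alpha> + 1) * real (capacity T v) - 1) / ((\<alpha> + 1) * real n - 1)"

text \<open>For an admissible model the attractions form a probability distribution on the vertices of
  every tree that the process reaches with positive probability (for \<open>Ary d\<close> they may be negative
  on other trees, which do not contribute). The tree after \<open>k\<close> steps has size \<open>k + 1\<close>.\<close>

definition attracting_vertex :: "model \<Rightarrow> nat \<Rightarrow> btree \<Rightarrow> nat list pmf" where
  "attracting_vertex M n T =
     embed_pmf (\<lambda>v. if v \<in> vertices T then attraction M n T v else 0)"

primrec evolution :: "nat \<Rightarrow> model \<Rightarrow> nat \<Rightarrow> btree pmf" where
  "evolution b M 0 = return_pmf (Node [1] [])"
| "evolution b M (Suc k) =
     bind_pmf (evolution b M k) (\<lambda>T.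
       bind_pmf (attracting_vertex M (k + 1) T) (attach b (k + 2) T))"


subsection \<open>The six properties\<close>

definition modelled_by ::
  "nat \<Rightarrow> (nat \<Rightarrow> real) \<Rightarrow> (nat \<Rightarrow> real) \<Rightarrow> model \<Rightarrow> bool" where
  "modelled_by b \<phi> \<psi> M \<longleftrightarrow>
     (\<exists>a s. a > 0 \<and> s > 0 \<and>
        (\<forall>k. \<phi> k = a ^ b * s powi (int k - 1) * model_phi b M k) \<and>
        (\<forall>k\<in>{1..<b}. \<psi> k = a ^ k * s powi (-1) * model_psi M k))"

definition generated_by ::
  "nat \<Rightarrow> (nat \<Rightarrow> real) \<Rightarrow> (nat \<Rightarrow> real) \<Rightarrow> model \<Rightarrow> bool" where
  "generated_by b \<phi> \<psi> M \<longleftrightarrow>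
     all_sizes b \<phi> \<psi> \<and> (\<forall>k. random_tree b \<phi> \<psi> (k + 1) = evolution b M k)"

definition combinatorial_model ::
  "nat \<Rightarrow> (nat \<Rightarrow> real) \<Rightarrow> (nat \<Rightarrow> real) \<Rightarrow> bool" where
  "combinatorial_model b \<phi> \<psi> \<longleftrightarrow> (\<exists>M. admissible b M \<and> modelled_by b \<phi> \<psi> M)"

definition affine_ratio ::
  "nat \<Rightarrow> (nat \<Rightarrow> real) \<Rightarrow> (nat \<Rightarrow> real) \<Rightarrow> bool" where
  "affine_ratio b \<phi> \<psi> \<longleftrightarrow>
     all_sizes b \<phi> \<psi> \<and>
     (\<exists>c1 c2. \<forall>n\<ge>1. total_weight b \<phi> \<psi> (n + 1) / total_weight b \<phi> \<psi> n = c1 * real n + c2)"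

definition evolution_process ::
  "nat \<Rightarrow> (nat \<Rightarrow> real) \<Rightarrow> (nat \<Rightarrow> real) \<Rightarrow> bool" where
  "evolution_process b \<phi> \<psi> \<longleftrightarrow> (\<exists>M. admissible b M \<and> generated_by b \<phi> \<psi> M)"

definition growth_rule ::
  "nat \<Rightarrow> (nat \<Rightarrow> real) \<Rightarrow> (nat \<Rightarrow> real) \<Rightarrow> bool" where
  "growth_rule b \<phi> \<psi> \<longleftrightarrow>
     all_sizes b \<phi> \<psi> \<and>
     (\<forall>n\<ge>1. \<exists>p :: btree \<Rightarrow> nat list pmf.
        (\<forall>T'\<in>bucket_trees b n. set_pmf (p T') \<subseteq> vertices T') \<and>
        bind_pmf (random_tree b \<phi> \<psi> n) (\<lambda>T'. bind_pmf (p T') (attach b (n + 1) T')) =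
          random_tree b \<phi> \<psi> (n + 1))"

definition randomness_preserved ::
  "nat \<Rightarrow> (nat \<Rightarrow> real) \<Rightarrow> (nat \<Rightarrow> real) \<Rightarrow> bool" where
  "randomness_preserved b \<phi> \<psi> \<longleftrightarrow>
     all_sizes b \<phi> \<psi> \<and>
     (\<forall>j n. 1 \<le> j \<and> j \<le> n \<longrightarrow>
        map_pmf (remove_above j) (random_tree b \<phi> \<psi> n) = random_tree b \<phi> \<psi> j)"

definition unsaturated_count :: "btree \<Rightarrow> nat \<Rightarrow> nat" where
  "unsaturated_count T k = card {u \<in> vertices T. capacity T u = k}"

definition saturated_count :: "nat \<Rightarrow> btree \<Rightarrow> nat \<Rightarrow> nat" where
  "saturated_count b T k = card {u \<in> vertices T. capacity T u = b \<and> outdeg T u = k}"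

definition psi_ext :: "nat \<Rightarrow> (nat \<Rightarrow> real) \<Rightarrow> (nat \<Rightarrow> real) \<Rightarrow> nat \<Rightarrow> real" where
  "psi_ext b \<phi> \<psi> k = (if k = b then \<phi> 0 else \<psi> k)"

text \<open>On trees of the family every quotient with a nonzero multiplicity has a positive
  denominator, and the second sum has only finitely many nonzero terms.\<close>

definition balance_sum ::
  "nat \<Rightarrow> (nat \<Rightarrow> real) \<Rightarrow> (nat \<Rightarrow> real) \<Rightarrow> btree \<Rightarrow> real" where
  "balance_sum b \<phi> \<psi> T =
     (\<Sum>k\<in>{1..<b}. real (unsaturated_count T k) *
        (psi_ext b \<phi> \<psi> (k + 1) / psi_ext b \<phi> \<psi> k)) +
     (\<Sum>k. real (saturated_count b T k) * real (k + 1) * psi_ext b \<phi> \<psi> 1 *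
        (\<phi> (k + 1) / \<phi> k))"

text \<open>As for the other properties, the family is required to contain trees of every size.
  Otherwise, e.g., the strictly binary trees with \<open>b = 1\<close>, \<open>\<phi> 0 = \<phi> 2 = 1\<close> and all other weights
  zero would be balanced, every sum being zero.\<close>

definition balanced ::
  "nat \<Rightarrow> (nat \<Rightarrow> real) \<Rightarrow> (nat \<Rightarrow> real) \<Rightarrow> bool" where
  "balanced b \<phi> \<psi> \<longleftrightarrow>
     all_sizes b \<phi> \<psi> \<and>
     (\<exists>C. \<forall>n\<ge>1. \<forall>T\<in>family b \<phi> \<psi> n. C n = balance_sum b \<phi> \<psi> T)"

end

theory Submission
  imports Defs
begin

text \<open>
  All six properties are equivalent to affine growth of the weights: for some \<open>\<alpha> > 0\<close> and \<open>\<beta>\<close>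
  with \<open>\<alpha> + \<beta> > 0\<close>, attaching the next label to a vertex of capacity \<open>c\<close> and out-degree \<open>k\<close>
  multiplies the weight of a tree, summed over the \<open>k + 1\<close> positions, by \<open>\<alpha> c + \<beta> (1 - k)\<close>.
  Summing over the vertices of a tree of size \<open>n\<close> gives the tree-independent factor \<open>\<alpha> n + \<beta>\<close>,
  so affine growth implies the affine ratio, the growth rule and the evolution process; the sign of
  \<open>\<beta>\<close> decides which of the three families occurs. The growth rule implies preservation of
  randomness because removing the last label inverts its insertion, and preservation implies
  balance.

  Conversely, comparing the balance sums of chains, of stars and of trees whose root has two leaf
  children forces affine growth. If only the ratio of the total weights is known to be affine, then
  weights with affine growth and the same total weights exist, and total weights determine the
  weights: in size \<open>b + k\<close> the weight \<open>\<phi> k\<close> enters only through the trees whose root has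
  degree \<open>k\<close>, linearly and with positive coefficient, and no later weight enters at all.
\<close>

section \<open>Trees as nested lists of labels\<close>

text \<open>Scaling the weights multiplies \<open>\<alpha>\<close> and \<open>\<beta>\<close> by a
  common factor, so the invariant of a family is their ratio; it fixes the attraction probabilities
  and, through the recursion for the weights, the weights up to scaling. Integrality of (d - 1) b
  comes from nonnegativity: if \<open>\<beta> > 0\<close>, the factor \<alpha> b + \<beta> - \<beta>
  k must vanish at some integer k before it turns negative. Two obstacles shape the details. Weights
  may vanish, so the recursions are written as products and laws are examined only on trees of
  positive weight. And \<open>Ary 1\<close> is admissible although its trees are chains and its
  closed formulas degenerate. The step from a process back to weights therefore passes through
  weights given by plain products, which realise the process of every admissible model. Preservation
  of randomness then carries over to the given weights, because apart from the existence of all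
  sizes it concerns distributions only.\<close>

lemma vertices_Node:
  "vertices (Node ls ts) = insert [] (\<Union>i<length ts. (#) i ` vertices (ts ! i))"
proof -
  have "is_vertex (Node ls ts) v \<longleftrightarrow> v \<in> insert [] (\<Union>i<length ts. (#) i ` vertices (ts ! i))" for v
    by (cases v) (auto simp: vertices_def)
  then show ?thesis by (auto simp: vertices_def)
qed

lemma Nil_in_vertices [simp]: "[] \<in> vertices T"
  by (simp add: vertices_def)

lemma Cons_in_vertices [simp]:
  "i # v \<in> vertices T \<longleftrightarrow> i < length (children T) \<and> v \<in> vertices (children T ! i)"
  by (simp add: vertices_def)

lemma finite_vertices [simp]: "finite (vertices T)"
proof (induction T)
  case (Node ls ts)
  then show ?case by (auto simp: vertices_Node)
qed

lemma sum_vertices_Node: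
  fixes f :: "nat list \<Rightarrow> 'a::comm_monoid_add"
  shows "(\<Sum>v\<in>vertices (Node ls ts). f v) =
    f [] + (\<Sum>i<length ts. \<Sum>v\<in>vertices (ts ! i). f (i # v))"
proof -
  have "(\<Sum>v\<in>(\<Union>i<length ts. (#) i ` vertices (ts ! i)). f v) =
      (\<Sum>i<length ts. \<Sum>v\<in>(#) i ` vertices (ts ! i). f v)"
    by (rule sum.UNION_disjoint) auto
  then show ?thesis
    unfolding vertices_Node by (subst sum.insert) (auto simp: sum.reindex)
qed

lemma prod_vertices_Node:
  fixes f :: "nat list \<Rightarrow> 'a::comm_monoid_mult"
  shows "(\<Prod>v\<in>vertices (Node ls ts). f v) =
    f [] * (\<Prod>i<length ts. \<Prod>v\<in>vertices (ts ! i). f (i # v))"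
proof -
  have "(\<Prod>v\<in>(\<Union>i<length ts. (#) i ` vertices (ts ! i)). f v) =
      (\<Prod>i<length ts. \<Prod>v\<in>(#) i ` vertices (ts ! i). f v)"
    by (rule prod.UNION_disjoint) auto
  then show ?thesis
    unfolding vertices_Node by (subst prod.insert) (auto simp: prod.reindex)
qed

lemma bucket_at_simps [simp]:
  "bucket_at T [] = bucket T" "bucket_at T (i # v) = bucket_at (children T ! i) v"
  by (simp_all add: bucket_at_def)

lemma capacity_simps [simp]:
  "capacity T [] = length (bucket T)" "capacity T (i # v) = capacity (children T ! i) v"
  by (simp_all add: capacity_def)

lemma outdeg_simps [simp]:
  "outdeg T [] = length (children T)" "outdeg T (i # v) = outdeg (children T ! i) v"
  by (simp_all add: outdeg_def)

lemma node_weight_Cons [simp]: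
  "node_weight b \<phi> \<psi> T (i # v) = node_weight b \<phi> \<psi> (children T ! i) v"
  by (simp add: node_weight_def)

lemma tree_size_Node: "tree_size (Node ls ts) = length ls + sum_list (map tree_size ts)"
  by (simp add: tree_size_def sum_vertices_Node sum_list_sum_nth atLeast0LessThan)

lemma tree_weight_Node:
  "tree_weight b \<phi> \<psi> (Node ls ts) =
    (if length ls = b then \<phi> (length ts) else \<psi> (length ls)) *
    prod_list (map (tree_weight b \<phi> \<psi>) ts)"
  by (simp add: tree_weight_def prod_vertices_Node prod.list_conv_set_nth atLeast0LessThan)
    (simp add: node_weight_def)


section \<open>Recursive form of the tree conditions\<close>

fun labels :: "btree \<Rightarrow> nat list" where
  "labels (Node ls ts) = ls @ concat (map labels ts)"

text \<open>The local conditions: capacities, saturation of internal nodes, order within buckets and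
  along edges. Subtrees inherit them, unlike the condition that the labels are exactly 1, ..., n,
  which is kept apart through \<open>labels\<close>.\<close>

fun wf_btree :: "nat \<Rightarrow> btree \<Rightarrow> bool" where
  "wf_btree b (Node ls ts) \<longleftrightarrow>
     length ls \<in> {1..b} \<and> (ts \<noteq> [] \<longrightarrow> length ls = b) \<and> sorted_wrt (<) ls \<and>
     (\<forall>t\<in>set ts. \<forall>x\<in>set ls. \<forall>y\<in>set (bucket t). x < y) \<and> (\<forall>t\<in>set ts. wf_btree b t)"

lemma all_vertices_Node:
  "(\<forall>v\<in>vertices (Node ls ts). P v) \<longleftrightarrow>
    P [] \<and> (\<forall>i<length ts. \<forall>v\<in>vertices (ts ! i). P (i # v))"
  by (auto simp: vertices_Node)

lemma all_edges_Node:
  "(\<forall>v i. v @ [i] \<in> vertices (Node ls ts) \<longrightarrow> P v (v @ [i])) \<longleftrightarrow>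
    (\<forall>i<length ts. P [] [i]) \<and>
    (\<forall>j<length ts. \<forall>v i. v @ [i] \<in> vertices (ts ! j) \<longrightarrow> P (j # v) (j # v @ [i]))"
  (is "?L \<longleftrightarrow> ?R")
proof
  assume ?L
  show ?R
  proof (intro conjI allI impI)
    fix i assume "i < length ts"
    with \<open>?L\<close>[rule_format, of "[]" i] show "P [] [i]" by simp
  next
    fix j v i assume "j < length ts" "v @ [i] \<in> vertices (ts ! j)"
    with \<open>?L\<close>[rule_format, of "j # v" i] show "P (j # v) (j # v @ [i])" by simp
  qed
next
  assume ?R
  show ?L
  proof (intro allI impI)
    fix v i assume "v @ [i] \<in> vertices (Node ls ts)"
    then show "P v (v @ [i])"
      using conjunct1[OF \<open>?R\<close>, rule_format, of i]
        conjunct2[OF \<open>?R\<close>, rule_format, of "hd v" "tl v" i]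
      by (cases v) simp_all
  qed
qed

lemma wf_btree_iff:
  "wf_btree b T \<longleftrightarrow> bucket_ordered b T \<and> (\<forall>v\<in>vertices T. sorted_wrt (<) (bucket_at T v)) \<and>
     (\<forall>v i. v @ [i] \<in> vertices T \<longrightarrow>
        (\<forall>x\<in>set (bucket_at T v). \<forall>y\<in>set (bucket_at T (v @ [i])). x < y))"
proof (induction T)
  case (Node ls ts)
  let ?inc = "\<lambda>T v u. \<forall>x\<in>set (bucket_at T v). \<forall>y\<in>set (bucket_at T u). x < y"
  have ord: "bucket_ordered b (Node ls ts) \<longleftrightarrow>
      length ls \<in> {1..b} \<and> (ts \<noteq> [] \<longrightarrow> length ls = b) \<and> (\<forall>t\<in>set ts. bucket_ordered b t)"
    unfolding bucket_ordered_def all_vertices_Node by (simp add: all_set_conv_all_nth)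
  have sort: "(\<forall>v\<in>vertices (Node ls ts). sorted_wrt (<) (bucket_at (Node ls ts) v)) \<longleftrightarrow>
      sorted_wrt (<) ls \<and> (\<forall>t\<in>set ts. \<forall>v\<in>vertices t. sorted_wrt (<) (bucket_at t v))"
    unfolding all_vertices_Node by (simp add: all_set_conv_all_nth)
  have inc: "(\<forall>v i. v @ [i] \<in> vertices (Node ls ts) \<longrightarrow> ?inc (Node ls ts) v (v @ [i])) \<longleftrightarrow>
      (\<forall>t\<in>set ts. \<forall>x\<in>set ls. \<forall>y\<in>set (bucket t). x < y) \<and>
      (\<forall>t\<in>set ts. \<forall>v i. v @ [i] \<in> vertices t \<longrightarrow> ?inc t v (v @ [i]))"
    unfolding all_edges_Node[where P = "?inc (Node ls ts)"]
    by (simp add: all_set_conv_all_nth)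
  have IH: "(\<forall>t\<in>set ts. wf_btree b t) \<longleftrightarrow> (\<forall>t\<in>set ts. bucket_ordered b t) \<and>
      (\<forall>t\<in>set ts. \<forall>v\<in>vertices t. sorted_wrt (<) (bucket_at t v)) \<and>
      (\<forall>t\<in>set ts. \<forall>v i. v @ [i] \<in> vertices t \<longrightarrow> ?inc t v (v @ [i]))"
    unfolding ball_conj_distrib[symmetric] by (rule ball_cong[OF refl Node.IH])
  show ?case
    unfolding wf_btree.simps ord sort inc IH by (simp only: conj_ac)
qed

lemma length_labels: "length (labels T) = tree_size T"
proof (induction T)
  case (Node ls ts)
  then show ?case by (simp add: tree_size_Node length_concat comp_def cong: map_cong)
qed

lemma set_labels: "set (labels T) = (\<Union>v\<in>vertices T. set (bucket_at T v))"
proof (induction T)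
  case (Node ls ts)
  have "(\<Union>t\<in>set ts. set (labels t)) = (\<Union>i<length ts. set (labels (ts ! i)))"
    by (auto simp: set_conv_nth)
  also have "\<dots> = (\<Union>i<length ts. \<Union>v\<in>vertices (ts ! i). set (bucket_at (ts ! i) v))"
    using Node.IH by simp
  finally show ?case by (simp add: vertices_Node)
qed

lemma distinct_concat_nth_eq:
  assumes "distinct (concat xss)" "i < length xss" "j < length xss"
    and "x \<in> set (xss ! i)" "x \<in> set (xss ! j)"
  shows "i = j"
  using assms
proof (induction xss arbitrary: i j)
  case (Cons xs xss)
  then show ?case by (cases i; cases j) (auto dest!: nth_mem)
qed simp

lemma bucket_at_subset_labels: "v \<in> vertices T \<Longrightarrow> set (bucket_at T v) \<subseteq> set (labels T)"
  by (auto simp: set_labels)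

lemma distinct_labels_unique:
  assumes "distinct (labels T)" "u \<in> vertices T" "v \<in> vertices T"
    and "x \<in> set (bucket_at T u)" "x \<in> set (bucket_at T v)"
  shows "u = v"
  using assms
proof (induction T arbitrary: u v)
  case (Node ls ts)
  have sub: "x \<in> set (concat (map labels ts))"
    if "i # w \<in> vertices (Node ls ts)" "x \<in> set (bucket_at (Node ls ts) (i # w))" for i w
    using that bucket_at_subset_labels[of w "ts ! i"] by (auto intro!: bexI[of _ "ts ! i"])
  show ?case
  proof (cases u)
    case Nil
    then show ?thesis using Node.prems sub by (cases v) auto
  next
    case u: (Cons i u')
    show ?thesis
    proof (cases v)
      case Nil
      then show ?thesis using Node.prems sub u by auto
    next
      case v: (Cons j v')
      have "i = j"
        by (rule distinct_concat_nth_eq[of "map labels ts" i j x])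
          (use Node.prems u v bucket_at_subset_labels in auto)
      moreover have "distinct (labels (ts ! i))"
        using Node.prems u by (auto simp: distinct_concat_iff)
      ultimately show ?thesis
        using Node.IH[of "ts ! i" u' v'] Node.prems u v by auto
    qed
  qed
qed

text \<open>The label list has length \<open>tree_size T\<close>. If it covers n values in a tree of
  size n, counting makes it distinct; conversely, distinctness recovers the size and the
  disjointness of the buckets.\<close>

lemma in_bucket_trees_iff:
  "T \<in> bucket_trees b n \<longleftrightarrow> wf_btree b T \<and> distinct (labels T) \<and> set (labels T) = {1..n}"
proof
  assume T: "T \<in> bucket_trees b n"
  then have labels: "set (labels T) = {1..n}" "tree_size T = n"
    by (auto simp: bucket_trees_def increasingly_labelled_def set_labels)
  then have "distinct (labels T)"
    by (intro card_distinct) (simp add: length_labels)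
  with labels T show "wf_btree b T \<and> distinct (labels T) \<and> set (labels T) = {1..n}"
    by (auto simp: bucket_trees_def increasingly_labelled_def wf_btree_iff)
next
  assume T: "wf_btree b T \<and> distinct (labels T) \<and> set (labels T) = {1..n}"
  then have "tree_size T = n"
    by (metis card_atLeastAtMost diff_Suc_1 distinct_card length_labels)
  moreover have "disjoint_family_on (\<lambda>v. set (bucket_at T v)) (vertices T)"
    using T by (auto simp: disjoint_family_on_def dest: distinct_labels_unique)
  ultimately show "T \<in> bucket_trees b n"
    using T by (auto simp: bucket_trees_def increasingly_labelled_def wf_btree_iff set_labels)
qed

lemma bucket_tree_size: "T \<in> bucket_trees b n \<Longrightarrow> tree_size T = n"
  by (simp add: bucket_trees_def)

section \<open>Inserting the largest label\<close>

definition insert_label :: "nat \<Rightarrow> nat \<Rightarrow> nat \<Rightarrow> btree \<Rightarrow> btree" where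
  "insert_label b x i t =
     (if length (bucket t) < b then Node (bucket t @ [x]) (children t)
      else Node (bucket t) (take i (children t) @ Node [x] [] # drop i (children t)))"

definition grow :: "nat \<Rightarrow> nat \<Rightarrow> btree \<Rightarrow> nat list \<Rightarrow> nat \<Rightarrow> btree" where
  "grow b x T v i = update_at (insert_label b x i) T v"

lemma update_at_cong:
  "f (subtree_at T v) = g (subtree_at T v) \<Longrightarrow> update_at f T v = update_at g T v"
  by (induction v arbitrary: T) auto

lemma wf_btree_children: "wf_btree b T \<Longrightarrow> t \<in> set (children T) \<Longrightarrow> wf_btree b t"
  by (cases T) auto

lemma wf_btree_capacity:
  assumes "wf_btree b T" "v \<in> vertices T"
  shows "1 \<le> capacity T v" "capacity T v \<le> b" "outdeg T v > 0 \<Longrightarrow> capacity T v = b"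
  using assms by (auto simp: wf_btree_iff bucket_ordered_def)

lemma bucket_nonempty: "wf_btree b T \<Longrightarrow> bucket T \<noteq> []"
  by (cases T) auto

text \<open>At an unsaturated vertex the range of positions is just {0}, so the uniform choice is
  deterministic and one formula covers both branches of \<open>attach\<close>.\<close>

lemma attach_eq_grow:
  assumes "wf_btree b T" "v \<in> vertices T"
  shows "attach b x T v = map_pmf (grow b x T v) (pmf_of_set {0..outdeg T v})"
proof (cases "capacity T v < b")
  case True
  then have "outdeg T v = 0"
    using wf_btree_capacity(3)[OF assms] by linarith
  moreover have "update_at (\<lambda>t. Node (bucket t @ [x]) (children t)) T v = grow b x T v 0"
    unfolding grow_def
    by (rule update_at_cong) (use True in \<open>simp add: insert_label_def capacity_def bucket_at_def\<close>)
  ultimately show ?thesis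
    using True by (simp add: attach_def pmf_of_set_singleton)
next
  case False
  have "update_at (\<lambda>t. Node (bucket t)
      (take i (children t) @ Node [x] [] # drop i (children t))) T v = grow b x T v i" for i
    unfolding grow_def
    by (rule update_at_cong) (use False in \<open>simp add: insert_label_def capacity_def bucket_at_def\<close>)
  then show ?thesis
    using False by (simp add: attach_def)
qed

lemma bucket_grow: "bucket (grow b x T v i) = bucket T \<or> bucket (grow b x T v i) = bucket T @ [x]"
  by (cases v) (auto simp: grow_def insert_label_def)

lemma grow_Cons: "grow b x T (k # v) i =
    Node (bucket T) ((children T)[k := grow b x (children T ! k) v i])"
  by (simp add: grow_def)

text \<open>The new label lands somewhere inside the label list, so only the multiset has a simple
  description. It yields both the set of labels and distinctness.\<close>

lemma mset_labels_grow:
  assumes "v \<in> vertices T"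
  shows "mset (labels (grow b x T v i)) = mset (x # labels T)"
  using assms
proof (induction v arbitrary: T)
  case Nil
  obtain ls ts where T: "T = Node ls ts" by (cases T)
  have "mset (concat (map labels ts)) =
      mset (concat (map labels (take i ts))) + mset (concat (map labels (drop i ts)))"
    by (metis append_take_drop_id concat_append map_append mset_append)
  then show ?case by (simp add: T grow_def insert_label_def)
next
  case (Cons k v)
  obtain ls ts where T: "T = Node ls ts" by (cases T)
  with Cons.prems have k: "k < length ts" and v: "v \<in> vertices (ts ! k)" by auto
  have "mset (concat (map labels ts)) = mset (concat (map labels (take k ts))) +
      mset (labels (ts ! k)) + mset (concat (map labels (drop (Suc k) ts)))"
    by (subst (1) id_take_nth_drop[OF k]) simp
  then show ?case
    using Cons.IH[OF v] k by (simp add: T grow_Cons upd_conv_take_nth_drop)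
qed

lemma set_labels_grow:
  "v \<in> vertices T \<Longrightarrow> set (labels (grow b x T v i)) = insert x (set (labels T))"
  by (metis list.simps(15) mset_labels_grow mset_eq_setD)

lemma distinct_labels_grow:
  "v \<in> vertices T \<Longrightarrow> distinct (labels (grow b x T v i)) \<longleftrightarrow> x \<notin> set (labels T) \<and> distinct (labels T)"
  by (metis distinct.simps(2) mset_eq_imp_distinct_iff mset_labels_grow)

lemma wf_btree_grow:
  assumes "wf_btree b T" "\<forall>y\<in>set (labels T). y < x" "v \<in> vertices T" "b \<ge> 1"
  shows "wf_btree b (grow b x T v i)"
  using assms
proof (induction v arbitrary: T)
  case Nil
  obtain ls ts where T: "T = Node ls ts" by (cases T)
  show ?case
  proof (cases "length ls < b")
    case True
    then show ?thesis using Nil.prems by (auto simp: T grow_def insert_label_def sorted_wrt_append)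
  next
    case False
    then show ?thesis
      using Nil.prems
      by (auto simp: T grow_def insert_label_def dest!: in_set_takeD[of _ i ts] in_set_dropD[of _ i ts])
  qed
next
  case (Cons k v)
  obtain ls ts where T: "T = Node ls ts" by (cases T)
  with Cons.prems have k: "k < length ts" and v: "v \<in> vertices (ts ! k)"
    and wf: "wf_btree b (ts ! k)" by auto
  have lt: "\<forall>y\<in>set (labels (ts ! k)). y < x"
    using Cons.prems(2) k by (auto simp: T)
  let ?t = "grow b x (ts ! k) v i"
  have "wf_btree b ?t"
    using Cons.IH[OF wf lt v \<open>b \<ge> 1\<close>] .
  moreover have "\<forall>z\<in>set ls. \<forall>y\<in>set (bucket ?t). z < y"
    using bucket_grow[of b x "ts ! k" v i] Cons.prems(1,2) nth_mem[OF k] by (auto simp: T)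
  ultimately show ?case
    using Cons.prems(1) k by (auto simp: T grow_Cons dest!: subsetD[OF set_update_subset_insert])
qed

section \<open>Removal of labels as the inverse of insertion\<close>

lemma remove_above_id:
  "wf_btree b T \<Longrightarrow> \<forall>y\<in>set (labels T). y \<le> j \<Longrightarrow> remove_above j T = T"
proof (induction T)
  case (Node ls ts)
  have "map (remove_above j) ts = ts"
    using Node by (intro map_idI) auto
  moreover have "filter (\<lambda>t. bucket t \<noteq> []) ts = ts"
    using Node.prems(1) by (auto simp: filter_id_conv dest: bucket_nonempty)
  ultimately show ?case using Node.prems(2) by (simp add: filter_id_conv)
qed

text \<open>Filtering drops \<open>x\<close> from an extended bucket and leaves a new bucket empty,
  which is then discarded; all other labels are at most \<open>j\<close> and stay.\<close>

lemma remove_above_grow: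
  assumes "wf_btree b T" "\<forall>y\<in>set (labels T). y \<le> j" "j < x" "v \<in> vertices T"
  shows "remove_above j (grow b x T v i) = T"
  using assms
proof (induction v arbitrary: T)
  case Nil
  obtain ls ts where T: "T = Node ls ts" by (cases T)
  have id: "map (remove_above j) ts = ts"
    using Nil.prems(1,2) by (intro map_idI) (auto simp: T intro!: remove_above_id)
  have ne: "filter (\<lambda>t. bucket t \<noteq> []) ts = ts"
    using Nil.prems(1) by (auto simp: T filter_id_conv dest: bucket_nonempty)
  have "filter (\<lambda>t. bucket t \<noteq> []) (map (remove_above j) (take i ts)) @
      filter (\<lambda>t. bucket t \<noteq> []) (map (remove_above j) (drop i ts)) = ts"
    by (metis append_take_drop_id filter_append map_append id ne)
  then show ?case
    using Nil.prems(2,3) id ne by (simp add: T grow_def insert_label_def filter_id_conv)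
next
  case (Cons k v)
  obtain ls ts where T: "T = Node ls ts" by (cases T)
  with Cons.prems have k: "k < length ts" and v: "v \<in> vertices (ts ! k)"
    and wf: "wf_btree b (ts ! k)" and le: "\<forall>y\<in>set (labels (ts ! k)). y \<le> j" by auto
  have id: "map (remove_above j) ts = ts"
    using Cons.prems(1,2) by (intro map_idI) (auto simp: T intro!: remove_above_id)
  have ne: "filter (\<lambda>t. bucket t \<noteq> []) ts = ts"
    using Cons.prems(1) by (auto simp: T filter_id_conv dest: bucket_nonempty)
  show ?case
    using Cons.IH[OF wf le \<open>j < x\<close> v] Cons.prems(2) id ne
    by (simp add: T grow_Cons map_update filter_id_conv)
qed

text \<open>Growth at the root and growth below it are told apart by the number of children, since a
  root with children is saturated and would gain another child. Growth in different children is told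
  apart by where the fresh label \<open>x\<close> occurs.\<close>

lemma grow_inj:
  assumes "wf_btree b T" "x \<notin> set (labels T)"
    and "v \<in> vertices T" "i \<le> outdeg T v" "v' \<in> vertices T" "i' \<le> outdeg T v'"
    and "grow b x T v i = grow b x T v' i'"
  shows "v = v' \<and> i = i'"
  using assms
proof (induction v arbitrary: T v')
  case Nil
  obtain ls ts where T: "T = Node ls ts" by (cases T)
  show ?case
  proof (cases v')
    case v': Nil
    show ?thesis
    proof (cases "length ls < b")
      case True
      then show ?thesis using Nil.prems v' by (auto simp: T)
    next
      case False
      have eq: "take i ts @ Node [x] [] # drop i ts = take i' ts @ Node [x] [] # drop i' ts"
        using Nil.prems(7) v' False by (simp add: T grow_def insert_label_def)
      have notin: "Node [x] [] \<notin> set (take i ts)" "Node [x] [] \<notin> set (take i' ts)"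
        using Nil.prems(2) by (force simp: T dest: in_set_takeD)+
      \<comment> \<open>As \<open>x\<close> is fresh, no old child equals the new bucket, so its
        position can be read off as the length of the prefix before it.\<close>
      have tw: "takeWhile (\<lambda>t. t \<noteq> Node [x] []) (us @ Node [x] [] # us') = us"
        if "Node [x] [] \<notin> set us" for us us'
        using that by (subst takeWhile_append2) auto
      have "length (take i ts) = length (take i' ts)"
        using tw[OF notin(1)] tw[OF notin(2)] eq by metis
      then show ?thesis using Nil.prems v' by (simp add: T)
    qed
  next
    case (Cons k u)
    then have "length (bucket T) = b" and "length ts > 0"
      using Nil.prems(1,5) by (auto simp: T)
    then show ?thesis
      using Nil.prems(7) Cons
      by (auto simp: T grow_def insert_label_def dest!: arg_cong[of _ _ length])
  qed
next
  case (Cons k v)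
  obtain ls ts where T: "T = Node ls ts" by (cases T)
  with Cons.prems have k: "k < length ts" and v: "v \<in> vertices (ts ! k)"
    and wf: "wf_btree b (ts ! k)" and x: "x \<notin> set (labels (ts ! k))" and i: "i \<le> outdeg (ts ! k) v"
    by auto
  show ?case
  proof (cases v')
    case Nil
    have "length (bucket T) = b"
      using Cons.prems(1,3) by (auto simp: T)
    then show ?thesis
      using Cons.prems(7) Nil
      by (auto simp: T grow_def insert_label_def dest!: arg_cong[of _ _ length])
  next
    case v': (Cons k' u)
    then have k': "k' < length ts" and u: "u \<in> vertices (ts ! k')" and i': "i' \<le> outdeg (ts ! k') u"
      using Cons.prems by (auto simp: T)
    have eq: "ts[k := grow b x (ts ! k) v i] = ts[k' := grow b x (ts ! k') u i']"
      using Cons.prems(7) v' by (simp add: T grow_Cons)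
    have "k = k'"
    proof (rule ccontr)
      assume "k \<noteq> k'"
      then have "grow b x (ts ! k) v i = ts ! k"
        using arg_cong[OF eq, of "\<lambda>l. l ! k"] k by simp
      then show False using set_labels_grow[OF v, of b x i] x by auto
    qed
    then have "grow b x (ts ! k) v i = grow b x (ts ! k) u i'"
      using arg_cong[OF eq, of "\<lambda>l. l ! k"] k by simp
    then show ?thesis
      using Cons.IH[OF wf x v i] u i' \<open>k = k'\<close> v' by auto
  qed
qed

text \<open>The node holding the largest label has no children, since they would carry larger
  labels, and the label is last in its bucket. It can be taken out of the bucket, or the whole node
  deleted if it held nothing else; the excluded tree is the one of which nothing would
  remain.\<close>

lemma obtain_grow:
  assumes "wf_btree b T" "distinct (labels T)" "x \<in> set (labels T)" "\<forall>y\<in>set (labels T). y \<le> x"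
    and "T \<noteq> Node [x] []"
  shows "\<exists>T' v i. wf_btree b T' \<and> v \<in> vertices T' \<and> i \<le> outdeg T' v \<and> T = grow b x T' v i"
  using assms
proof (induction T)
  case (Node ls ts)
  show ?case
  proof (cases "x \<in> set ls")
    case True
    have "ts = []"
    proof (rule ccontr)
      assume "ts \<noteq> []"
      then obtain t where t: "t \<in> set ts" by (cases ts) auto
      then have "bucket t \<noteq> []" using Node.prems(1) bucket_nonempty by auto
      then obtain y where y: "y \<in> set (bucket t)" by (cases "bucket t") auto
      then have "x < y" using Node.prems(1) True t by auto
      moreover have "y \<in> set (labels t)" using y by (cases t) auto
      then have "y \<le> x" using Node.prems(4) t by auto
      ultimately show False by simp
    qed
    have ls: "ls \<noteq> []" "sorted_wrt (<) ls" "length ls \<le> b"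
      using Node.prems(1) by auto
    have "last ls = x"
    proof (rule ccontr)
      assume ne: "last ls \<noteq> x"
      have dec: "ls = butlast ls @ [last ls]" using ls(1) by simp
      have "sorted_wrt (<) (butlast ls @ [last ls])" using ls(2) dec by simp
      then have "\<forall>y\<in>set (butlast ls). y < last ls" by (simp add: sorted_wrt_append)
      moreover have "x \<in> set (butlast ls)"
        using True ne dec by (metis Un_iff empty_iff empty_set set_ConsD set_append)
      ultimately have "x < last ls" by blast
      moreover have "last ls \<le> x" using Node.prems(4) ls(1) by simp
      ultimately show False by simp
    qed
    then have dec: "ls = butlast ls @ [x]" using ls(1) by (metis append_butlast_last_id)
    have "butlast ls \<noteq> []" using Node.prems(5) dec \<open>ts = []\<close> by (metis append_Nil)
    moreover have "sorted_wrt (<) (butlast ls)"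
      using ls(2) dec by (metis sorted_wrt_append)
    ultimately have "wf_btree b (Node (butlast ls) [])"
      using ls(3) by (auto simp: Suc_le_eq simp flip: length_greater_0_conv)
    moreover have "grow b x (Node (butlast ls) []) [] 0 = Node ls ts"
      using ls(1,3) dec \<open>ts = []\<close>
      by (auto simp: grow_def insert_label_def less_eq_Suc_le simp flip: length_greater_0_conv)
    ultimately show ?thesis
      by (intro exI[of _ "Node (butlast ls) []"] exI[of _ "[]"] exI[of _ 0]) simp
  next
    case False
    then obtain k where k: "k < length ts" "x \<in> set (labels (ts ! k))"
      using Node.prems(3) by (auto simp: in_set_conv_nth[of _ ts])
    have len: "length ls = b" using Node.prems(1) k by auto
    have tk: "ts ! k \<in> set ts" using k by simp
    show ?thesis
    proof (cases "ts ! k = Node [x] []")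
      \<comment> \<open>A node left without labels is not well-formed, so the deletion is performed
        at its parent, and position \<open>k\<close> restores it.\<close>
      case True
      let ?T = "Node ls (take k ts @ drop (Suc k) ts)"
      have "wf_btree b ?T"
        using Node.prems(1) len by (auto dest!: in_set_takeD in_set_dropD)
      moreover have "grow b x ?T [] k = Node ls ts"
        using len k(1) True id_take_nth_drop[OF k(1)] by (simp add: grow_def insert_label_def)
      ultimately show ?thesis
        using k(1) by (intro exI[of _ ?T] exI[of _ "[]"] exI[of _ k]) simp
    next
      case False
      have "distinct (labels (ts ! k))"
        using Node.prems(2) tk by (auto simp: distinct_concat_iff)
      then obtain t v i where t: "wf_btree b t" "v \<in> vertices t" "i \<le> outdeg t v"
          "ts ! k = grow b x t v i"
        using Node.IH[OF tk] Node.prems(1,4) tk k(2) False by fastforce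
      let ?T = "Node ls (ts[k := t])"
      have "set (bucket t) \<subseteq> set (bucket (ts ! k))"
        using bucket_grow[of b x t v i] t(4) by auto
      then have "\<forall>z\<in>set ls. \<forall>y\<in>set (bucket t). z < y"
        using Node.prems(1) tk by auto
      then have "wf_btree b ?T"
        using Node.prems(1) t(1) len by (auto dest!: subsetD[OF set_update_subset_insert])
      moreover have "grow b x ?T (k # v) i = Node ls ts"
        using k(1) t(4) by (simp add: grow_Cons) (metis list_update_id)
      ultimately show ?thesis
        using t k(1) by (intro exI[of _ ?T] exI[of _ "k # v"] exI[of _ i]) simp
    qed
  qed
qed

section \<open>Enumeration of the trees of each size\<close>

lemma tree_size_pos: "wf_btree b T \<Longrightarrow> tree_size T \<ge> 1"
  by (cases T) (auto simp: tree_size_Node)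

lemma length_le_sum_tree_size:
  "\<forall>t\<in>set ts. wf_btree b t \<Longrightarrow> length ts \<le> sum_list (map tree_size ts)"
  by (induction ts) (auto dest: tree_size_pos)

text \<open>A root with children is saturated and has at least one more label below it, which
  already gives more than \<open>b\<close> labels.\<close>

lemma bucket_trees_small:
  assumes "1 \<le> n" "n \<le> b"
  shows "bucket_trees b n = {Node [1..<Suc n] []}"
proof -
  have "T = Node [1..<Suc n] []" if "T \<in> bucket_trees b n" for T
  proof -
    obtain ls ts where T: "T = Node ls ts" by (cases T)
    have wf: "wf_btree b T" and set: "set (labels T) = {1..n}"
      using that by (auto simp: in_bucket_trees_iff)
    have "tree_size T = n" using that bucket_tree_size by blast
    have "ts = []"
    proof (rule ccontr)
      assume "ts \<noteq> []"
      then have "length ls = b" "1 \<le> length ts" using wf by (auto simp: T Suc_le_eq)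
      moreover have "length ts \<le> sum_list (map tree_size ts)"
        using wf by (intro length_le_sum_tree_size[of _ b]) (simp add: T)
      ultimately show False
        using \<open>tree_size T = n\<close> assms unfolding T tree_size_Node by linarith
    qed
    moreover have "ls = [1..<Suc n]"
    proof (rule sorted_distinct_set_unique)
      have "sorted_wrt (<) ls" using wf by (simp add: T)
      then have "sorted ls \<and> distinct ls" by (rule iffD1[OF strict_sorted_iff])
      then show "sorted ls" "distinct ls" by blast+
      have "set ls = {1..n}" using set unfolding T \<open>ts = []\<close> by simp
      then show "set ls = set [1..<Suc n]" by (simp only: set_upt atLeastLessThanSuc_atLeastAtMost)
    qed (simp_all only: sorted_upt distinct_upt)
    ultimately show ?thesis by (simp only: T)
  qed
  moreover have "Node [1..<Suc n] [] \<in> bucket_trees b n"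
    using assms by (auto simp: in_bucket_trees_iff simp del: upt_Suc)
  ultimately show ?thesis by blast
qed

lemma bucket_trees_0: "bucket_trees b 0 = {}"
  using tree_size_pos bucket_tree_size in_bucket_trees_iff by fastforce

text \<open>An unsaturated vertex of a well-formed tree has out-degree 0, hence exactly one slot, so
  saturated and unsaturated vertices need not be distinguished.\<close>

definition slots :: "btree \<Rightarrow> (nat list \<times> nat) set" where
  "slots T = (SIGMA v:vertices T. {0..outdeg T v})"

lemma finite_slots [simp]: "finite (slots T)"
  by (simp add: slots_def)

lemma grow_in_bucket_trees:
  assumes "b \<ge> 1" "T \<in> bucket_trees b n" "v \<in> vertices T"
  shows "grow b (Suc n) T v i \<in> bucket_trees b (Suc n)"
    and "remove_above n (grow b (Suc n) T v i) = T"
proof -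
  have T: "wf_btree b T" "distinct (labels T)" "set (labels T) = {1..n}"
    using assms by (auto simp: in_bucket_trees_iff)
  have "wf_btree b (grow b (Suc n) T v i)"
    using T assms by (intro wf_btree_grow) auto
  moreover have "insert (Suc n) {1..n} = {1..Suc n}"
    by (simp add: atLeastAtMostSuc_conv)
  ultimately show "grow b (Suc n) T v i \<in> bucket_trees b (Suc n)"
    using T assms(3) by (simp add: in_bucket_trees_iff set_labels_grow distinct_labels_grow)
  show "remove_above n (grow b (Suc n) T v i) = T"
    using T assms(3) by (intro remove_above_grow) auto
qed

lemma grow_eq_iff:
  assumes "b \<ge> 1" "T \<in> bucket_trees b n" "(v, i) \<in> slots T" "T' \<in> bucket_trees b n" "(v', i') \<in> slots T'"
  shows "grow b (Suc n) T v i = grow b (Suc n) T' v' i' \<longleftrightarrow> T = T' \<and> v = v' \<and> i = i'"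
proof
  assume eq: "grow b (Suc n) T v i = grow b (Suc n) T' v' i'"
  have TT: "T = T'"
    using grow_in_bucket_trees(2)[OF assms(1,2), of v i]
      grow_in_bucket_trees(2)[OF assms(1,4), of v' i'] eq assms(3,5) by (auto simp: slots_def)
  then show "T = T' \<and> v = v' \<and> i = i'"
    using grow_inj[of b T "Suc n" v i v' i'] eq assms by (auto simp: slots_def in_bucket_trees_iff)
qed auto

lemma bucket_tree_obtain_grow:
  assumes "b \<ge> 1" "n \<ge> 1" "T \<in> bucket_trees b (Suc n)"
  obtains T' v i where "T' \<in> bucket_trees b n" "(v, i) \<in> slots T'" "T = grow b (Suc n) T' v i"
proof -
  have T: "wf_btree b T" "distinct (labels T)" "set (labels T) = {1..Suc n}"
    using assms by (auto simp: in_bucket_trees_iff)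
  have "T \<noteq> Node [Suc n] []"
  proof
    assume "T = Node [Suc n] []"
    with T(3) have "{Suc n} = {1..Suc n}" by simp
    then have "1 \<in> {Suc n}" by simp
    with assms(2) show False by simp
  qed
  then obtain T' v i where T': "wf_btree b T'" "v \<in> vertices T'" "i \<le> outdeg T' v"
      "T = grow b (Suc n) T' v i"
    using obtain_grow[of b T "Suc n"] T by auto
  then have "Suc n \<notin> set (labels T')" "distinct (labels T')"
    using T(2) distinct_labels_grow by auto
  moreover have "insert (Suc n) (set (labels T')) = {1..Suc n}"
    using T(3) T'(2,4) set_labels_grow by auto
  then have "insert (Suc n) (set (labels T')) = insert (Suc n) {1..n}"
    by (simp add: atLeastAtMostSuc_conv)
  then have "set (labels T') = {1..n}"
    using \<open>Suc n \<notin> set (labels T')\<close> by (subst (asm) insert_ident) simp_all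
  ultimately show ?thesis
    using that[of T' v i] T' by (simp add: in_bucket_trees_iff slots_def)
qed

lemma bucket_trees_Suc:
  assumes "b \<ge> 1" "n \<ge> 1"
  shows "bucket_trees b (Suc n) =
    (\<lambda>(T, v, i). grow b (Suc n) T v i) ` (SIGMA T:bucket_trees b n. slots T)"
proof (intro equalityI subsetI)
  fix T assume "T \<in> bucket_trees b (Suc n)"
  then show "T \<in> (\<lambda>(T, v, i). grow b (Suc n) T v i) ` (SIGMA T:bucket_trees b n. slots T)"
    by (rule bucket_tree_obtain_grow[OF assms]) force
next
  fix T assume "T \<in> (\<lambda>(T, v, i). grow b (Suc n) T v i) ` (SIGMA T:bucket_trees b n. slots T)"
  then show "T \<in> bucket_trees b (Suc n)"
    using grow_in_bucket_trees(1)[OF assms(1)] by (auto simp: slots_def)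
qed

lemma finite_bucket_trees [simp]:
  assumes "b \<ge> 1"
  shows "finite (bucket_trees b n)"
proof (induction n)
  case (Suc n)
  show ?case
  proof (cases "n = 0")
    case True
    then show ?thesis using bucket_trees_small[of 1 b] assms by simp
  next
    case False
    then show ?thesis using assms Suc by (subst bucket_trees_Suc) auto
  qed
qed (simp add: bucket_trees_0)

text \<open>Every tree of size n + 1 arises from exactly one tree and one slot. This is the
  recursion behind all statements on total weights.\<close>

lemma sum_bucket_trees_Suc:
  fixes f :: "btree \<Rightarrow> 'a::comm_monoid_add"
  assumes "b \<ge> 1" "n \<ge> 1"
  shows "(\<Sum>T\<in>bucket_trees b (Suc n). f T) =
    (\<Sum>T\<in>bucket_trees b n. \<Sum>v\<in>vertices T. \<Sum>i\<le>outdeg T v. f (grow b (Suc n) T v i))"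
proof -
  have inj: "inj_on (\<lambda>(T, v, i). grow b (Suc n) T v i) (SIGMA T:bucket_trees b n. slots T)"
    using grow_eq_iff[OF assms(1)] by (auto simp: inj_on_def)
  have "(\<Sum>T\<in>bucket_trees b (Suc n). f T) =
      (\<Sum>(T, v, i)\<in>(SIGMA T:bucket_trees b n. slots T). f (grow b (Suc n) T v i))"
    unfolding bucket_trees_Suc[OF assms] sum.reindex[OF inj] by (simp add: case_prod_unfold)
  also have "\<dots> = (\<Sum>T\<in>bucket_trees b n. \<Sum>(v, i)\<in>slots T. f (grow b (Suc n) T v i))"
    using assms by (subst sum.Sigma) auto
  also have "\<dots> = (\<Sum>T\<in>bucket_trees b n. \<Sum>v\<in>vertices T. \<Sum>i\<le>outdeg T v. f (grow b (Suc n) T v i))"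
    by (simp add: slots_def sum.Sigma atLeast0AtMost)
  finally show ?thesis .
qed

lemma children_of_bucket_tree:
  assumes "b \<ge> 1" "n \<ge> 1" "T \<in> bucket_trees b n"
  shows "{U \<in> bucket_trees b (Suc n). remove_above n U = T} =
    (\<lambda>(v, i). grow b (Suc n) T v i) ` slots T"
proof (intro equalityI subsetI)
  fix U assume U: "U \<in> {U \<in> bucket_trees b (Suc n). remove_above n U = T}"
  then obtain T' v i where T': "T' \<in> bucket_trees b n" "(v, i) \<in> slots T'" "U = grow b (Suc n) T' v i"
    using bucket_tree_obtain_grow[OF assms(1,2)] by blast
  then have "T' = T"
    using U grow_in_bucket_trees(2)[OF assms(1) T'(1)] by (auto simp: slots_def)
  with T' show "U \<in> (\<lambda>(v, i). grow b (Suc n) T v i) ` slots T" by auto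
next
  fix U assume "U \<in> (\<lambda>(v, i). grow b (Suc n) T v i) ` slots T"
  then show "U \<in> {U \<in> bucket_trees b (Suc n). remove_above n U = T}"
    using grow_in_bucket_trees[OF assms(1,3)] by (auto simp: slots_def)
qed

lemma sum_children_of_bucket_tree:
  fixes f :: "btree \<Rightarrow> 'a::comm_monoid_add"
  assumes "b \<ge> 1" "n \<ge> 1" "T \<in> bucket_trees b n"
  shows "(\<Sum>U\<in>{U \<in> bucket_trees b (Suc n). remove_above n U = T}. f U) =
    (\<Sum>v\<in>vertices T. \<Sum>i\<le>outdeg T v. f (grow b (Suc n) T v i))"
proof -
  have inj: "inj_on (\<lambda>(v, i). grow b (Suc n) T v i) (slots T)"
    using grow_eq_iff[OF assms(1)] assms(3) by (auto simp: inj_on_def)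
  show ?thesis
    unfolding children_of_bucket_tree[OF assms] sum.reindex[OF inj]
    by (simp add: slots_def sum.Sigma atLeast0AtMost case_prod_unfold)
qed

lemma bucket_remove_above: "bucket (remove_above j T) = filter (\<lambda>x. x \<le> j) (bucket T)"
  by (cases T) simp

lemma remove_above_remove_above:
  assumes "j \<le> n"
  shows "remove_above j (remove_above n T) = remove_above j T"
proof (induction T)
  case (Node ls ts)
  have "filter (\<lambda>t. bucket t \<noteq> []) (map (remove_above j) (filter (\<lambda>t. bucket t \<noteq> []) (map (remove_above n) ts)))
      = filter (\<lambda>t. bucket t \<noteq> []) (map (remove_above j) ts)"
    using Node
  proof (induction ts)
    case (Cons t ts)
    then show ?case using assms by (auto simp: bucket_remove_above filter_empty_conv)
  qed simp
  moreover have "filter (\<lambda>x. x \<le> j \<and> x \<le> n) ls = filter (\<lambda>x. x \<le> j) ls"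
    using assms by (intro filter_cong) auto
  ultimately show ?case by (simp add: conj_commute)
qed

text \<open>The weight is a product over nodes, so replacing a subtree leaves the outer factors
  alone. The cofactor \<open>K\<close> serves all \<open>f\<close> at once; defining it as a
  quotient would fail for subtrees of weight zero.\<close>

lemma tree_weight_update_at:
  assumes "v \<in> vertices T"
  shows "\<exists>K. \<forall>f. tree_weight b \<phi> \<psi> (update_at f T v) = K * tree_weight b \<phi> \<psi> (f (subtree_at T v))"
  using assms
proof (induction v arbitrary: T)
  case Nil
  show ?case by (intro exI[of _ 1]) simp
next
  case (Cons k v)
  obtain ls ts where T: "T = Node ls ts" by (cases T)
  with Cons.prems have k: "k < length ts" and v: "v \<in> vertices (ts ! k)" by auto
  obtain K where K: "\<And>f. tree_weight b \<phi> \<psi> (update_at f (ts ! k) v) =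
      K * tree_weight b \<phi> \<psi> (f (subtree_at (ts ! k) v))"
    using Cons.IH[OF v] by auto
  let ?w = "if length ls = b then \<phi> (length ts) else \<psi> (length ls)"
  let ?p = "\<lambda>us. prod_list (map (tree_weight b \<phi> \<psi>) us)"
  have "tree_weight b \<phi> \<psi> (update_at f T (k # v)) =
      ?w * ?p (take k ts) * ?p (drop (Suc k) ts) * K * tree_weight b \<phi> \<psi> (f (subtree_at T (k # v)))" for f
  proof -
    have "tree_weight b \<phi> \<psi> (update_at f T (k # v)) =
        ?w * ?p (ts[k := update_at f (ts ! k) v])"
      by (simp add: T tree_weight_Node)
    then show ?thesis
      using k by (simp add: T upd_conv_take_nth_drop K mult_ac)
  qed
  then show ?case by blast
qed

lemma update_at_id: "v \<in> vertices T \<Longrightarrow> update_at (\<lambda>t. t) T v = T"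
proof (induction v arbitrary: T)
  case (Cons k v)
  then show ?case by (cases T) auto
qed simp

lemma tree_weight_leaf: "tree_weight b \<phi> \<psi> (Node ls []) = psi_ext b \<phi> \<psi> (length ls)"
  by (simp add: tree_weight_Node psi_ext_def)

text \<open>What replaces the factor \<open>node_weight\<close> when \<open>v\<close> receives a
  label, including the factor of a new bucket. For b = 1 the new bucket is saturated at once, and
  filling the last free place turns a node into a saturated leaf; \<open>psi_ext\<close> supplies
  \<open>\<phi> 0\<close> in both cases.\<close>

definition grown_weight :: "nat \<Rightarrow> (nat \<Rightarrow> real) \<Rightarrow> (nat \<Rightarrow> real) \<Rightarrow> btree \<Rightarrow> nat list \<Rightarrow> real" where
  "grown_weight b \<phi> \<psi> T v =
     (if capacity T v < b then psi_ext b \<phi> \<psi> (capacity T v + 1)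
      else \<phi> (outdeg T v + 1) * psi_ext b \<phi> \<psi> 1)"

lemma tree_weight_grow:
  assumes "wf_btree b T" "v \<in> vertices T"
  obtains K where "tree_weight b \<phi> \<psi> T = K * node_weight b \<phi> \<psi> T v"
    and "\<And>x i. i \<le> outdeg T v \<Longrightarrow> tree_weight b \<phi> \<psi> (grow b x T v i) = K * grown_weight b \<phi> \<psi> T v"
proof -
  obtain K where K: "\<And>f. tree_weight b \<phi> \<psi> (update_at f T v) =
      K * tree_weight b \<phi> \<psi> (f (subtree_at T v))"
    using tree_weight_update_at[OF assms(2)] by blast
  obtain ls ts where t: "subtree_at T v = Node ls ts" by (cases "subtree_at T v")
  let ?p = "\<lambda>us. prod_list (map (tree_weight b \<phi> \<psi>) us)"
  have cap: "capacity T v = length ls" and deg: "outdeg T v = length ts"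
    by (simp_all add: capacity_def bucket_at_def outdeg_def t)
  have ts: "ts = []" if "length ls < b"
    using wf_btree_capacity(3)[OF assms] that by (auto simp: cap deg)
  have le: "length ls \<le> b"
    using wf_btree_capacity(2)[OF assms] by (simp add: cap)
  have T: "tree_weight b \<phi> \<psi> T = K * (node_weight b \<phi> \<psi> T v * ?p ts)"
    using K[of "\<lambda>t. t"]
    by (simp add: update_at_id[OF assms(2)] t tree_weight_Node node_weight_def cap deg)
  have split: "?p (take i ts) * ?p (drop i ts) = ?p ts" for i
    by (metis append_take_drop_id map_append prod_list.append)
  have G: "tree_weight b \<phi> \<psi> (grow b x T v i) = K * (grown_weight b \<phi> \<psi> T v * ?p ts)"
    if "i \<le> outdeg T v" for x i
  proof (cases "length ls < b")
    case True
    then show ?thesis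
      by (simp add: grow_def K t insert_label_def grown_weight_def cap ts tree_weight_leaf)
  next
    case False
    then have len: "length ls = b" using le by simp
    have "tree_weight b \<phi> \<psi> (insert_label b x i (Node ls ts)) =
        \<phi> (length ts + 1) * (?p (take i ts) * (psi_ext b \<phi> \<psi> 1 * ?p (drop i ts)))"
      using len that
      by (simp add: insert_label_def tree_weight_Node[of _ _ _ ls] tree_weight_leaf deg)
    also have "\<dots> = grown_weight b \<phi> \<psi> T v * ?p ts"
      unfolding split[of i, symmetric] by (simp add: grown_weight_def cap deg len)
    finally show ?thesis by (simp add: grow_def K t)
  qed
  show ?thesis
    by (rule that[of "K * ?p ts"]) (use T G in \<open>simp_all add: mult_ac\<close>)
qed

section \<open>Affine growth\<close>

text \<open>The growth law multiplied out, so that zero weights are covered: the first line is for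
  unsaturated leaves of capacity \<open>k\<close>, with k + 1 = b prescribing
  \<open>\<phi> 0\<close>; the second is for saturated nodes of out-degree \<open>k\<close> with
  their k + 1 positions.\<close>

definition affine_weights ::
  "nat \<Rightarrow> (nat \<Rightarrow> real) \<Rightarrow> (nat \<Rightarrow> real) \<Rightarrow> real \<Rightarrow> real \<Rightarrow> bool" where
  "affine_weights b \<phi> \<psi> \<alpha> \<beta> \<longleftrightarrow>
     (\<forall>k\<in>{1..<b}. psi_ext b \<phi> \<psi> (k + 1) = psi_ext b \<phi> \<psi> k * (\<alpha> * real k + \<beta>)) \<and>
     (\<forall>k. \<phi> (k + 1) * real (k + 1) * psi_ext b \<phi> \<psi> 1 = \<phi> k * (\<alpha> * real b + \<beta> - \<beta> * real k))"

definition attract :: "real \<Rightarrow> real \<Rightarrow> btree \<Rightarrow> nat list \<Rightarrow> real" where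
  "attract \<alpha> \<beta> T v = \<alpha> * real (capacity T v) + \<beta> * (1 - real (outdeg T v))"

lemma grown_weight_affine:
  assumes "affine_weights b \<phi> \<psi> \<alpha> \<beta>" "wf_btree b T" "v \<in> vertices T"
  shows "grown_weight b \<phi> \<psi> T v * real (outdeg T v + 1) = node_weight b \<phi> \<psi> T v * attract \<alpha> \<beta> T v"
proof (cases "capacity T v < b")
  case True
  then have "outdeg T v = 0" "capacity T v \<in> {1..<b}"
    using wf_btree_capacity[OF assms(2,3)] by force+
  with True assms(1) show ?thesis
    by (simp add: affine_weights_def grown_weight_def node_weight_def attract_def psi_ext_def[of _ _ _ "capacity T v"])
next
  case False
  then have "capacity T v = b"
    using wf_btree_capacity[OF assms(2,3)] by simp
  moreover have "\<phi> (outdeg T v + 1) * real (outdeg T v + 1) * psi_ext b \<phi> \<psi> 1 =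
      \<phi> (outdeg T v) * (\<alpha> * real b + \<beta> - \<beta> * real (outdeg T v))"
    using assms(1) unfolding affine_weights_def by blast
  ultimately show ?thesis
    unfolding grown_weight_def node_weight_def attract_def by (simp add: algebra_simps)
qed

lemma tree_weight_grow_affine:
  assumes "affine_weights b \<phi> \<psi> \<alpha> \<beta>" "wf_btree b T" "v \<in> vertices T" "i \<le> outdeg T v"
  shows "tree_weight b \<phi> \<psi> (grow b x T v i) * real (outdeg T v + 1) =
    tree_weight b \<phi> \<psi> T * attract \<alpha> \<beta> T v"
proof -
  obtain K where "tree_weight b \<phi> \<psi> T = K * node_weight b \<phi> \<psi> T v"
    "tree_weight b \<phi> \<psi> (grow b x T v i) = K * grown_weight b \<phi> \<psi> T v"
    using tree_weight_grow[OF assms(2,3)] assms(4) by metis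
  then show ?thesis
    using grown_weight_affine[OF assms(1-3)] by (simp add: mult.assoc)
qed

text \<open>A tree has one vertex more than it has edges, so the terms 1 - \<open>outdeg\<close> add
  up to 1.\<close>

lemma sum_attract: "(\<Sum>v\<in>vertices T. attract \<alpha> \<beta> T v) = \<alpha> * real (tree_size T) + \<beta>"
proof (induction T)
  case (Node ls ts)
  have Cons: "attract \<alpha> \<beta> (Node ls ts) (i # v) = attract \<alpha> \<beta> (ts ! i) v" for i v
    by (simp add: attract_def)
  have "(\<Sum>v\<in>vertices (Node ls ts). attract \<alpha> \<beta> (Node ls ts) v) =
      attract \<alpha> \<beta> (Node ls ts) [] + (\<Sum>i<length ts. \<alpha> * real (tree_size (ts ! i)) + \<beta>)"
    using Node.IH by (simp add: sum_vertices_Node Cons)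
  also have "\<dots> = \<alpha> * real (length ls) + \<beta> + \<alpha> * (\<Sum>i<length ts. real (tree_size (ts ! i)))"
    by (simp add: attract_def sum.distrib sum_distrib_left algebra_simps)
  also have "\<dots> = \<alpha> * real (tree_size (Node ls ts)) + \<beta>"
    by (simp add: tree_size_Node sum_list_sum_nth atLeast0LessThan algebra_simps)
  finally show ?case .
qed

lemma sum_tree_weight_grow_affine:
  assumes "affine_weights b \<phi> \<psi> \<alpha> \<beta>" "T \<in> bucket_trees b n"
  shows "(\<Sum>v\<in>vertices T. \<Sum>i\<le>outdeg T v. tree_weight b \<phi> \<psi> (grow b x T v i)) =
    tree_weight b \<phi> \<psi> T * (\<alpha> * real n + \<beta>)"
proof -
  have wf: "wf_btree b T" using assms(2) by (simp add: in_bucket_trees_iff)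
  have "(\<Sum>i\<le>outdeg T v. tree_weight b \<phi> \<psi> (grow b x T v i)) = tree_weight b \<phi> \<psi> T * attract \<alpha> \<beta> T v"
    if v: "v \<in> vertices T" for v
  proof -
    have "tree_weight b \<phi> \<psi> (grow b x T v i) =
        tree_weight b \<phi> \<psi> T * attract \<alpha> \<beta> T v / real (outdeg T v + 1)" if "i \<le> outdeg T v" for i
      using tree_weight_grow_affine[OF assms(1) wf v that, of x] by (simp add: field_simps)
    then show ?thesis by simp
  qed
  then show ?thesis
    using bucket_tree_size[OF assms(2)]
    by (simp add: sum_attract[of \<alpha> \<beta> T] flip: sum_distrib_left)
qed

lemma total_weight_Suc_affine:
  assumes "affine_weights b \<phi> \<psi> \<alpha> \<beta>" "b \<ge> 1" "n \<ge> 1"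
  shows "total_weight b \<phi> \<psi> (Suc n) = total_weight b \<phi> \<psi> n * (\<alpha> * real n + \<beta>)"
  unfolding total_weight_def sum_bucket_trees_Suc[OF assms(2,3)] sum_distrib_right
  using sum_tree_weight_grow_affine[OF assms(1)] by simp

lemma total_weight_small:
  assumes "1 \<le> n" "n \<le> b"
  shows "total_weight b \<phi> \<psi> n = psi_ext b \<phi> \<psi> n"
  using assms by (simp add: total_weight_def bucket_trees_small tree_weight_leaf del: upt_Suc)

lemma all_sizes_affine:
  assumes "affine_weights b \<phi> \<psi> \<alpha> \<beta>" "b \<ge> 1" "psi_ext b \<phi> \<psi> 1 > 0"
    and pos: "\<And>n. n \<ge> 1 \<Longrightarrow> \<alpha> * real n + \<beta> > 0"
  shows "all_sizes b \<phi> \<psi>"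
proof -
  have "total_weight b \<phi> \<psi> n > 0" if "n \<ge> 1" for n
    using that
  proof (induction n rule: dec_induct)
    case base
    then show ?case using assms total_weight_small[of 1 b] by simp
  next
    case (step n)
    then show ?case using assms(1,2) pos[of n] by (simp add: total_weight_Suc_affine)
  qed
  then show ?thesis by (simp add: all_sizes_def)
qed

lemma pmf_embed_pmf_finite:
  assumes "finite A" "\<And>x. x \<in> A \<Longrightarrow> f x \<ge> 0" "(\<Sum>x\<in>A. f x) = 1"
  shows "pmf (embed_pmf (\<lambda>x. if x \<in> A then f x else 0)) x = (if x \<in> A then f x else 0)"
proof (rule pmf_embed_pmf)
  have "(\<integral>\<^sup>+x. ennreal (if x \<in> A then f x else 0) \<partial>count_space UNIV) =
      (\<Sum>x\<in>A. ennreal (if x \<in> A then f x else 0))"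
    using assms(1) by (intro nn_integral_count_space') auto
  also have "\<dots> = ennreal (\<Sum>x\<in>A. f x)"
    using assms(2) by (subst sum_ennreal[symmetric]) (auto intro!: sum.cong)
  finally show "(\<integral>\<^sup>+x. ennreal (if x \<in> A then f x else 0) \<partial>count_space UNIV) = 1"
    by (simp add: assms(3))
qed (use assms(2) in auto)

section \<open>Random trees\<close>

definition vertex_law :: "real \<Rightarrow> real \<Rightarrow> nat \<Rightarrow> btree \<Rightarrow> nat list pmf" where
  "vertex_law \<alpha> \<beta> n T =
     embed_pmf (\<lambda>v. if v \<in> vertices T then attract \<alpha> \<beta> T v / (\<alpha> * real n + \<beta>) else 0)"

text \<open>The exclusion of chains is a hypothesis of single lemmas instead, because the locale is
  also instantiated with the canonical weights of \<open>Ary 1\<close>, whose trees are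
  chains.\<close>

locale bucket_weights =
  fixes b :: nat and \<phi> \<psi> :: "nat \<Rightarrow> real"
  assumes b_pos: "b \<ge> 1"
    and phi_nonneg: "\<And>k. \<phi> k \<ge> 0"
    and phi_0_pos: "\<phi> 0 > 0"
    and psi_nonneg: "\<And>k. 1 \<le> k \<Longrightarrow> k < b \<Longrightarrow> \<psi> k \<ge> 0"
begin

abbreviation weight :: "btree \<Rightarrow> real" where "weight \<equiv> tree_weight b \<phi> \<psi>"
abbreviation total :: "nat \<Rightarrow> real" where "total \<equiv> total_weight b \<phi> \<psi>"
abbreviation \<Psi> :: "nat \<Rightarrow> real" where "\<Psi> \<equiv> psi_ext b \<phi> \<psi>"
abbreviation rtree :: "nat \<Rightarrow> btree pmf" where "rtree \<equiv> random_tree b \<phi> \<psi>"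

lemma weight_nonneg: "wf_btree b T \<Longrightarrow> weight T \<ge> 0"
proof (induction T)
  case (Node ls ts)
  have "prod_list (map weight ts) \<ge> 0"
    using Node by (intro prod_list_nonneg) auto
  then show ?case
    using Node.prems phi_nonneg psi_nonneg[of "length ls"] by (auto simp: tree_weight_Node)
qed

lemma pmf_random_tree:
  assumes "total n > 0"
  shows "pmf (rtree n) T = (if T \<in> bucket_trees b n then weight T / total n else 0)"
  unfolding random_tree_def
proof (rule pmf_embed_pmf_finite)
  show "finite (bucket_trees b n)" using b_pos by simp
  show "(\<Sum>T\<in>bucket_trees b n. weight T / total n) = 1"
    using assms by (simp add: total_weight_def flip: sum_divide_distrib)
qed (use assms weight_nonneg in \<open>auto simp: in_bucket_trees_iff\<close>)

lemma set_pmf_random_tree: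
  assumes "total n > 0"
  shows "set_pmf (rtree n) = family b \<phi> \<psi> n"
  using assms weight_nonneg
  by (auto simp: set_pmf_iff pmf_random_tree family_def in_bucket_trees_iff less_le split: if_splits)

text \<open>For \<open>\<beta> > 0\<close> a vertex of large out-degree would have negative
  attraction. On a tree of positive weight this cannot happen, since attraction times weight is a
  multiple of the nonnegative weight of a grown tree.\<close>

lemma pmf_vertex_law:
  assumes aff: "affine_weights b \<phi> \<psi> \<alpha> \<beta>" and pos: "\<alpha> * real n + \<beta> > 0"
    and T: "T \<in> family b \<phi> \<psi> n"
  shows "pmf (vertex_law \<alpha> \<beta> n T) v =
    (if v \<in> vertices T then attract \<alpha> \<beta> T v / (\<alpha> * real n + \<beta>) else 0)"
  unfolding vertex_law_def
proof (rule pmf_embed_pmf_finite)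
  have wf: "wf_btree b T" and tr: "T \<in> bucket_trees b n" and w: "weight T > 0"
    using T by (auto simp: family_def in_bucket_trees_iff)
  show "attract \<alpha> \<beta> T v / (\<alpha> * real n + \<beta>) \<ge> 0" if v: "v \<in> vertices T" for v
  proof -
    have "weight (grow b (Suc n) T v 0) \<ge> 0"
      using grow_in_bucket_trees(1)[OF b_pos tr v, of 0] weight_nonneg
      by (simp add: in_bucket_trees_iff)
    then have "weight T * attract \<alpha> \<beta> T v \<ge> 0"
      using tree_weight_grow_affine[OF aff wf v, of 0 "Suc n"]
      by (metis mult_nonneg_nonneg of_nat_0_le_iff zero_le)
    then show ?thesis using w pos by (simp add: zero_le_mult_iff)
  qed
  show "(\<Sum>v\<in>vertices T. attract \<alpha> \<beta> T v / (\<alpha> * real n + \<beta>)) = 1"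
    using pos bucket_tree_size[OF tr] by (simp add: sum_attract flip: sum_divide_distrib)
qed simp

lemma set_pmf_attach:
  assumes "T \<in> bucket_trees b n" "v \<in> vertices T"
  shows "set_pmf (attach b x T v) = grow b x T v ` {0..outdeg T v}"
  using assms by (subst attach_eq_grow) (auto simp: in_bucket_trees_iff)

text \<open>Only one tree, vertex and position lead to a given \<open>U\<close>, so its probability
  is a product of three factors, which the growth law turns into its weight over the total. The law
  \<open>p\<close> is prescribed on the family only, so the lemma applies both to the growth rule
  and to the evolution process.\<close>

lemma growth_step:
  assumes aff: "affine_weights b \<phi> \<psi> \<alpha> \<beta>" and n: "n \<ge> 1" and pos: "\<alpha> * real n + \<beta> > 0"
    and tot: "total n > 0"
    and p: "\<And>T v. T \<in> family b \<phi> \<psi> n \<Longrightarrow> pmf (p T) v =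
      (if v \<in> vertices T then attract \<alpha> \<beta> T v / (\<alpha> * real n + \<beta>) else 0)"
  shows "bind_pmf (rtree n) (\<lambda>T. bind_pmf (p T) (attach b (Suc n) T)) = rtree (Suc n)"
proof (rule pmf_eqI)
  fix U
  have totS: "total (Suc n) = total n * (\<alpha> * real n + \<beta>)"
    using total_weight_Suc_affine[OF aff b_pos n] .
  then have totS_pos: "total (Suc n) > 0" using tot pos by simp
  have p_sub: "set_pmf (p T) \<subseteq> vertices T" if "T \<in> family b \<phi> \<psi> n" for T
    using p[OF that] by (auto simp: set_pmf_iff split: if_splits)
  let ?N = "\<lambda>T. bind_pmf (p T) (attach b (Suc n) T)"
  have N: "\<exists>v i. (v, i) \<in> slots T \<and> U = grow b (Suc n) T v i \<and> v \<in> set_pmf (p T)"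
    if TU: "T \<in> family b \<phi> \<psi> n" "U \<in> set_pmf (?N T)" for T U
  proof -
    obtain v where v: "v \<in> set_pmf (p T)" "U \<in> set_pmf (attach b (Suc n) T v)"
      using TU(2) by auto
    then have "v \<in> vertices T" using p_sub[OF TU(1)] by auto
    moreover have "T \<in> bucket_trees b n" using TU(1) by (simp add: family_def)
    ultimately obtain i where "i \<in> {0..outdeg T v}" "U = grow b (Suc n) T v i"
      using v(2) set_pmf_attach by auto
    then show ?thesis using v \<open>v \<in> vertices T\<close> by (auto simp: slots_def)
  qed
  show "pmf (bind_pmf (rtree n) ?N) U = pmf (rtree (Suc n)) U"
  proof (cases "U \<in> bucket_trees b (Suc n)")
    case False
    have "U \<notin> set_pmf (bind_pmf (rtree n) ?N)"
    proof
      assume "U \<in> set_pmf (bind_pmf (rtree n) ?N)"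
      then obtain T where T: "T \<in> family b \<phi> \<psi> n" "U \<in> set_pmf (?N T)"
        unfolding set_bind_pmf set_pmf_random_tree[OF tot] by auto
      from N[OF this] False grow_in_bucket_trees(1)[OF b_pos] T(1) show False
        by (auto simp: family_def slots_def)
    qed
    then have "pmf (bind_pmf (rtree n) ?N) U = 0" by (simp only: set_pmf_iff not_not)
    then show ?thesis using False by (simp add: pmf_random_tree[OF totS_pos])
  next
    case True
    obtain T v i where T: "T \<in> bucket_trees b n" "(v, i) \<in> slots T" "U = grow b (Suc n) T v i"
      using bucket_tree_obtain_grow[OF b_pos n True] .
    have wf: "wf_btree b T" and v: "v \<in> vertices T" and i: "i \<le> outdeg T v"
      using T by (auto simp: in_bucket_trees_iff slots_def)
    have uniq: "T' = T \<and> v' = v" if "T' \<in> bucket_trees b n" "(v', i') \<in> slots T'"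
        "U = grow b (Suc n) T' v' i'" for T' v' i'
      using grow_eq_iff[OF b_pos that(1,2) T(1,2)] that(3) T(3) by simp
    have "pmf (bind_pmf (rtree n) ?N) U = (\<integral>T. pmf (?N T) U \<partial>rtree n)"
      by (rule pmf_bind)
    also have "\<dots> = (\<Sum>T\<in>{T}. pmf (?N T) U * pmf (rtree n) T)"
    proof (rule integral_measure_pmf_real)
      fix T' assume "T' \<in> set_pmf (rtree n)" "pmf (?N T') U \<noteq> 0"
      then have "T' \<in> family b \<phi> \<psi> n" "U \<in> set_pmf (?N T')"
        unfolding set_pmf_random_tree[OF tot] by (simp_all only: set_pmf_iff not_False_eq_True)
      with N[OF this] uniq show "T' \<in> {T}" by (auto simp: family_def)
    qed simp
    also have "\<dots> = weight U / total (Suc n)"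
    \<comment> \<open>If \<open>T\<close> has weight zero, nothing is known about
      \<open>p T\<close>; but then \<open>T\<close> has probability zero, and \<open>U\<close> has
      weight zero as well.\<close>
    proof (cases "weight T > 0")
      case False
      then have "weight T = 0" using weight_nonneg[OF wf] by simp
      then have "weight U = 0"
        using tree_weight_grow_affine[OF aff wf v i, of "Suc n"] T(3) by simp
      then show ?thesis using \<open>weight T = 0\<close> by (simp add: pmf_random_tree[OF tot])
    next
      case True
      then have fam: "T \<in> family b \<phi> \<psi> n" using T(1) by (simp add: family_def)
      have att: "attach b (Suc n) T v = map_pmf (grow b (Suc n) T v) (pmf_of_set {0..outdeg T v})"
        by (rule attach_eq_grow[OF wf v])
      have "pmf (attach b (Suc n) T v) U = pmf (pmf_of_set {0..outdeg T v}) i"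
        unfolding att T(3)
      proof (rule pmf_map_inj)
        show "inj_on (grow b (Suc n) T v) (set_pmf (pmf_of_set {0..outdeg T v}))"
          using grow_eq_iff[OF b_pos T(1) _ T(1)] v by (auto simp: inj_on_def slots_def)
      qed (use i in simp)
      then have pa: "pmf (attach b (Suc n) T v) U = 1 / real (outdeg T v + 1)"
        using i by simp
      have "pmf (?N T) U = (\<integral>v. pmf (attach b (Suc n) T v) U \<partial>p T)"
        by (rule pmf_bind)
      also have "\<dots> = (\<Sum>v\<in>{v}. pmf (attach b (Suc n) T v) U * pmf (p T) v)"
      proof (rule integral_measure_pmf_real)
        fix u assume u: "u \<in> set_pmf (p T)" "pmf (attach b (Suc n) T u) U \<noteq> 0"
        then have "u \<in> vertices T" using p_sub[OF fam] by auto
        moreover have "U \<in> set_pmf (attach b (Suc n) T u)" using u(2) by (simp add: set_pmf_iff)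
        ultimately show "u \<in> {v}"
          using set_pmf_attach[OF T(1), of u "Suc n"] uniq[OF T(1)] by (auto simp: slots_def)
      qed simp
      also have "\<dots> = attract \<alpha> \<beta> T v / (\<alpha> * real n + \<beta>) / real (outdeg T v + 1)"
        using pa p[OF fam] v by simp
      finally have "(\<Sum>T\<in>{T}. pmf (?N T) U * pmf (rtree n) T) =
          (weight T * attract \<alpha> \<beta> T v / real (outdeg T v + 1)) / ((\<alpha> * real n + \<beta>) * total n)"
        using T(1) by (simp add: pmf_random_tree[OF tot] mult_ac)
      also have "\<dots> = weight U / total (Suc n)"
        unfolding totS T(3) tree_weight_grow_affine[OF aff wf v i, of "Suc n", symmetric]
        by (simp add: mult_ac)
      finally show ?thesis .
    qed
    finally show ?thesis using True by (simp add: pmf_random_tree[OF totS_pos])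
  qed
qed

lemma growth_rule_if_affine:
  assumes aff: "affine_weights b \<phi> \<psi> \<alpha> \<beta>" and pos: "\<And>n. n \<ge> 1 \<Longrightarrow> \<alpha> * real n + \<beta> > 0"
    and all: "all_sizes b \<phi> \<psi>"
  shows "growth_rule b \<phi> \<psi>"
  unfolding growth_rule_def
proof (intro conjI allI impI all)
  fix n :: nat assume n: "n \<ge> 1"
  \<comment> \<open>Trees of weight zero also need a law supported on their vertices; the root
    serves as a default there.\<close>
  let ?p = "\<lambda>T. if T \<in> family b \<phi> \<psi> n then vertex_law \<alpha> \<beta> n T else return_pmf []"
  have "set_pmf (?p T) \<subseteq> vertices T" for T
    using pmf_vertex_law[OF aff pos[OF n], of T] by (auto simp: set_pmf_iff split: if_splits)
  moreover have "bind_pmf (rtree n) (\<lambda>T. bind_pmf (?p T) (attach b (Suc n) T)) = rtree (Suc n)"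
    using all n pmf_vertex_law[OF aff pos[OF n]]
    by (intro growth_step[OF aff n pos[OF n]]) (auto simp: all_sizes_def)
  ultimately show "\<exists>p. (\<forall>T'\<in>bucket_trees b n. set_pmf (p T') \<subseteq> vertices T') \<and>
      bind_pmf (rtree n) (\<lambda>T'. bind_pmf (p T') (attach b (n + 1) T')) = rtree (n + 1)"
    by (intro exI[of _ ?p]) simp
qed

lemma random_tree_1:
  assumes "all_sizes b \<phi> \<psi>"
  shows "rtree 1 = return_pmf (Node [1] [])"
proof -
  have "set_pmf (rtree 1) \<subseteq> {Node [1] []}"
    using assms bucket_trees_small[of 1 b] b_pos
    by (subst set_pmf_random_tree) (auto simp: all_sizes_def family_def)
  then show ?thesis by (simp add: set_pmf_subset_singleton)
qed

lemma generated_if_affine: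
  assumes aff: "affine_weights b \<phi> \<psi> \<alpha> \<beta>" and pos: "\<And>n. n \<ge> 1 \<Longrightarrow> \<alpha> * real n + \<beta> > 0"
    and all: "all_sizes b \<phi> \<psi>"
    and M: "\<And>n T v. attraction M n T v = attract \<alpha> \<beta> T v / (\<alpha> * real n + \<beta>)"
  shows "generated_by b \<phi> \<psi> M"
proof -
  have "rtree (Suc k) = evolution b M k" for k
  proof (induction k)
    case 0
    then show ?case using random_tree_1[OF all] by simp
  next
    case (Suc k)
    have law: "attracting_vertex M n T = vertex_law \<alpha> \<beta> n T" for n T
      by (simp add: attracting_vertex_def vertex_law_def M cong: if_cong)
    have "rtree (Suc (Suc k)) =
        bind_pmf (rtree (Suc k)) (\<lambda>T. bind_pmf (attracting_vertex M (Suc k) T) (attach b (Suc (Suc k)) T))"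
      unfolding law
      by (rule growth_step[OF aff, symmetric])
        (use all pos[of "Suc k"] pmf_vertex_law[OF aff pos[of "Suc k"]] in \<open>auto simp: all_sizes_def\<close>)
    then show ?case by (simp add: Suc)
  qed
  then show ?thesis using all by (simp add: generated_by_def)
qed

lemma preserved_if_growth_rule:
  assumes "growth_rule b \<phi> \<psi>"
  shows "randomness_preserved b \<phi> \<psi>"
proof -
  have all: "all_sizes b \<phi> \<psi>" using assms by (simp add: growth_rule_def)
  have step: "map_pmf (remove_above n) (rtree (Suc n)) = rtree n" if n: "n \<ge> 1" for n
  proof -
    obtain p where p: "\<forall>T\<in>bucket_trees b n. set_pmf (p T) \<subseteq> vertices T"
      "bind_pmf (rtree n) (\<lambda>T. bind_pmf (p T) (attach b (Suc n) T)) = rtree (Suc n)"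
      using assms n unfolding growth_rule_def by (metis Suc_eq_plus1)
    have fam: "set_pmf (rtree n) = family b \<phi> \<psi> n"
      using all n by (intro set_pmf_random_tree) (simp add: all_sizes_def)
    have "map_pmf (remove_above n) (rtree (Suc n)) =
        bind_pmf (rtree n) (\<lambda>T. bind_pmf (p T) (\<lambda>v. map_pmf (remove_above n) (attach b (Suc n) T v)))"
      unfolding p(2)[symmetric] by (simp add: map_bind_pmf)
    also have "\<dots> = bind_pmf (rtree n) return_pmf"
    proof (rule bind_pmf_cong[OF refl])
      fix T assume "T \<in> set_pmf (rtree n)"
      then have T: "T \<in> bucket_trees b n" by (simp add: fam family_def)
      have "map_pmf (remove_above n) (attach b (Suc n) T v) = return_pmf T" if "v \<in> set_pmf (p T)" for v
      proof -
        have v: "v \<in> vertices T" using p(1) T that by auto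
        have "set_pmf (map_pmf (remove_above n) (attach b (Suc n) T v)) \<subseteq> {T}"
          using grow_in_bucket_trees(2)[OF b_pos T v] set_pmf_attach[OF T v] by auto
        then show ?thesis by (simp only: set_pmf_subset_singleton)
      qed
      then have "bind_pmf (p T) (\<lambda>v. map_pmf (remove_above n) (attach b (Suc n) T v)) =
          bind_pmf (p T) (\<lambda>_. return_pmf T)"
        by (intro bind_pmf_cong) auto
      then show "bind_pmf (p T) (\<lambda>v. map_pmf (remove_above n) (attach b (Suc n) T v)) = return_pmf T"
        by simp
    qed
    finally show ?thesis by (simp add: bind_return_pmf')
  qed
  have "map_pmf (remove_above j) (rtree n) = rtree j" if "j \<le> n" "1 \<le> j" for j n
    using that
  proof (induction n rule: dec_induct)
    case base
    have "T \<in> set_pmf (rtree j) \<Longrightarrow> remove_above j T = T" for T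
      using all base by (subst (asm) set_pmf_random_tree)
        (auto simp: all_sizes_def family_def in_bucket_trees_iff intro!: remove_above_id)
    then have "map_pmf (remove_above j) (rtree j) = map_pmf (\<lambda>x. x) (rtree j)"
      by (intro map_pmf_cong) auto
    then show ?case by simp
  next
    case (step n)
    have "map_pmf (remove_above j) (rtree (Suc n)) =
        map_pmf (remove_above j) (map_pmf (remove_above n) (rtree (Suc n)))"
      using step.hyps by (simp add: map_pmf_comp remove_above_remove_above)
    also have "\<dots> = rtree j"
      using \<open>\<And>n. 1 \<le> n \<Longrightarrow> map_pmf (remove_above n) (rtree (Suc n)) = rtree n\<close>[of n] step by simp
    finally show ?case .
  qed
  then show ?thesis using all by (simp add: randomness_preserved_def)
qed

end

section \<open>Balance\<close>

text \<open>The relative gain of weight when a node of capacity \<open>c\<close> and out-degree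
  \<open>k\<close> receives a label, summed over its positions.\<close>

definition node_rate ::
  "nat \<Rightarrow> (nat \<Rightarrow> real) \<Rightarrow> (nat \<Rightarrow> real) \<Rightarrow> nat \<Rightarrow> nat \<Rightarrow> real" where
  "node_rate b \<phi> \<psi> c k =
     (if c < b then psi_ext b \<phi> \<psi> (c + 1) / psi_ext b \<phi> \<psi> c
      else real (k + 1) * psi_ext b \<phi> \<psi> 1 * (\<phi> (k + 1) / \<phi> k))"

text \<open>Grouping the vertices by capacity or out-degree replaces the counts. As a sum over
  vertices the balance sum becomes additive over subtrees, hence computable on chains and
  stars.\<close>

lemma balance_sum_eq:
  assumes "wf_btree b T"
  shows "balance_sum b \<phi> \<psi> T = (\<Sum>v\<in>vertices T. node_rate b \<phi> \<psi> (capacity T v) (outdeg T v))"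
proof -
  let ?f = "\<lambda>k. psi_ext b \<phi> \<psi> (k + 1) / psi_ext b \<phi> \<psi> k"
  let ?g = "\<lambda>k. real (k + 1) * psi_ext b \<phi> \<psi> 1 * (\<phi> (k + 1) / \<phi> k)"
  let ?U = "{v \<in> vertices T. capacity T v < b}" and ?S = "{v \<in> vertices T. capacity T v = b}"
  have "(\<Sum>k\<in>{1..<b}. real (unsaturated_count T k) * ?f k) =
      (\<Sum>k\<in>{1..<b}. \<Sum>v\<in>{v \<in> ?U. capacity T v = k}. ?f (capacity T v))"
  proof (rule sum.cong[OF refl])
    fix k assume "k \<in> {1..<b}"
    then have "{v \<in> ?U. capacity T v = k} = {v \<in> vertices T. capacity T v = k}" by auto
    then show "real (unsaturated_count T k) * ?f k =
        (\<Sum>v\<in>{v \<in> ?U. capacity T v = k}. ?f (capacity T v))"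
      by (simp add: unsaturated_count_def)
  qed
  also have "\<dots> = (\<Sum>v\<in>?U. ?f (capacity T v))"
    by (rule sum.group) (use wf_btree_capacity[OF assms] in auto)
  finally have 1: "(\<Sum>k\<in>{1..<b}. real (unsaturated_count T k) * ?f k) = (\<Sum>v\<in>?U. ?f (capacity T v))" .
  have "(\<Sum>k. real (saturated_count b T k) * real (k + 1) * psi_ext b \<phi> \<psi> 1 * (\<phi> (k + 1) / \<phi> k)) =
      (\<Sum>k\<in>outdeg T ` ?S. real (saturated_count b T k) * real (k + 1) * psi_ext b \<phi> \<psi> 1 * (\<phi> (k + 1) / \<phi> k))"
  proof (rule suminf_finite)
    fix k assume "k \<notin> outdeg T ` ?S"
    then have "{u \<in> vertices T. capacity T u = b \<and> outdeg T u = k} = {}" by auto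
    then have "saturated_count b T k = 0" unfolding saturated_count_def by simp
    then show "real (saturated_count b T k) * real (k + 1) * psi_ext b \<phi> \<psi> 1 * (\<phi> (k + 1) / \<phi> k) = 0"
      by simp
  qed simp
  also have "\<dots> = (\<Sum>k\<in>outdeg T ` ?S. \<Sum>v\<in>{v \<in> ?S. outdeg T v = k}. ?g (outdeg T v))"
    by (rule sum.cong) (simp_all add: saturated_count_def conj_ac)
  also have "\<dots> = (\<Sum>v\<in>?S. ?g (outdeg T v))"
    by (rule sum.group) auto
  finally have 2: "(\<Sum>k. real (saturated_count b T k) * real (k + 1) * psi_ext b \<phi> \<psi> 1 * (\<phi> (k + 1) / \<phi> k)) =
      (\<Sum>v\<in>?S. ?g (outdeg T v))" .
  have U: "vertices T = ?U \<union> ?S" "?U \<inter> ?S = {}"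
    using wf_btree_capacity(2)[OF assms] by (auto simp: order.order_iff_strict)
  have "(\<Sum>v\<in>vertices T. node_rate b \<phi> \<psi> (capacity T v) (outdeg T v)) =
      (\<Sum>v\<in>?U. node_rate b \<phi> \<psi> (capacity T v) (outdeg T v)) +
      (\<Sum>v\<in>?S. node_rate b \<phi> \<psi> (capacity T v) (outdeg T v))"
    by (subst U(1), rule sum.union_disjoint) (use U(2) in auto)
  then show ?thesis
    unfolding balance_sum_def 1 2 by (simp add: node_rate_def)
qed

lemma balance_sum_Node:
  assumes "wf_btree b (Node ls ts)"
  shows "balance_sum b \<phi> \<psi> (Node ls ts) =
    node_rate b \<phi> \<psi> (length ls) (length ts) + sum_list (map (balance_sum b \<phi> \<psi>) ts)"
proof -
  have "balance_sum b \<phi> \<psi> (ts ! i) =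
      (\<Sum>v\<in>vertices (ts ! i). node_rate b \<phi> \<psi> (capacity (ts ! i) v) (outdeg (ts ! i) v))"
    if "i < length ts" for i
    using assms that by (intro balance_sum_eq) auto
  then show ?thesis
    by (simp add: balance_sum_eq[OF assms] sum_vertices_Node sum_list_sum_nth atLeast0LessThan)
qed

context bucket_weights
begin

text \<open>This is the meaning of the balance sum: the total weight of all growths of a tree
  relative to its own. Positive weight ensures that no denominator at an occurring node
  vanishes.\<close>

lemma sum_weight_grow:
  assumes "T \<in> family b \<phi> \<psi> n"
  shows "(\<Sum>v\<in>vertices T. \<Sum>i\<le>outdeg T v. weight (grow b x T v i)) = weight T * balance_sum b \<phi> \<psi> T"
proof -
  have wf: "wf_btree b T" and w: "weight T > 0"
    using assms by (auto simp: family_def in_bucket_trees_iff)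
  have "(\<Sum>i\<le>outdeg T v. weight (grow b x T v i)) =
      weight T * node_rate b \<phi> \<psi> (capacity T v) (outdeg T v)" if v: "v \<in> vertices T" for v
  proof -
    obtain K where K: "weight T = K * node_weight b \<phi> \<psi> T v"
      "\<And>i. i \<le> outdeg T v \<Longrightarrow> weight (grow b x T v i) = K * grown_weight b \<phi> \<psi> T v"
      using tree_weight_grow[OF wf v] by metis
    then have nz: "node_weight b \<phi> \<psi> T v \<noteq> 0" using w by auto
    have "outdeg T v = 0" if "capacity T v < b"
      using wf_btree_capacity(3)[OF wf v] that by force
    then have "real (outdeg T v + 1) * grown_weight b \<phi> \<psi> T v =
        node_weight b \<phi> \<psi> T v * node_rate b \<phi> \<psi> (capacity T v) (outdeg T v)"
      using nz wf_btree_capacity(2)[OF wf v]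
      by (auto simp: grown_weight_def node_weight_def node_rate_def psi_ext_def[of _ _ _ "capacity T v"]
          split: if_splits)
    then show ?thesis using K by (simp add: algebra_simps)
  qed
  then show ?thesis
    by (simp add: balance_sum_eq[OF wf] sum_distrib_left)
qed

text \<open>Preservation from size n + 1 to n forces the growths of each tree to have total weight
  proportional to the weight of that tree. The common factor, and hence \<open>C n\<close>, is the
  ratio of consecutive total weights.\<close>

lemma balanced_if_preserved:
  assumes "randomness_preserved b \<phi> \<psi>"
  shows "balanced b \<phi> \<psi>"
proof -
  have all: "all_sizes b \<phi> \<psi>" using assms by (simp add: randomness_preserved_def)
  have "total (Suc n) / total n = balance_sum b \<phi> \<psi> T" if n: "n \<ge> 1" and T: "T \<in> family b \<phi> \<psi> n" for n T
  proof -
    have pos: "total n > 0" "total (Suc n) > 0"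
      using all n by (auto simp: all_sizes_def)
    have tr: "T \<in> bucket_trees b n" and w: "weight T > 0" using T by (auto simp: family_def)
    let ?C = "{U \<in> bucket_trees b (Suc n). remove_above n U = T}"
    have "weight T / total n = pmf (map_pmf (remove_above n) (rtree (Suc n))) T"
      using assms n tr by (simp add: randomness_preserved_def pmf_random_tree[OF pos(1)])
    also have "\<dots> = measure (rtree (Suc n)) (remove_above n -` {T})"
      by (rule pmf_map)
    also have "\<dots> = measure (rtree (Suc n)) ?C"
      by (rule measure_prob_cong_0) (auto simp: pmf_random_tree[OF pos(2)])
    also have "\<dots> = (\<Sum>U\<in>?C. pmf (rtree (Suc n)) U)"
      using b_pos by (intro measure_measure_pmf_finite) simp
    also have "\<dots> = (\<Sum>U\<in>?C. weight U / total (Suc n))"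
      by (rule sum.cong) (auto simp: pmf_random_tree[OF pos(2)])
    also have "\<dots> = weight T * balance_sum b \<phi> \<psi> T / total (Suc n)"
      unfolding sum_divide_distrib[symmetric] sum_children_of_bucket_tree[OF b_pos n tr]
        sum_weight_grow[OF T] ..
    finally show ?thesis using pos w by (simp add: field_simps)
  qed
  then show ?thesis
    unfolding balanced_def using all by (intro conjI exI[of _ "\<lambda>n. total (Suc n) / total n"]) auto
qed

lemma psi_ext_pos:
  assumes "all_sizes b \<phi> \<psi>" "1 \<le> k" "k \<le> b"
  shows "\<Psi> k > 0"
  using assms total_weight_small[of k b \<phi> \<psi>] by (metis all_sizes_def)

text \<open>The only tree of size \<open>b\<close> is a saturated leaf, so the weight of every tree
  of size b + 1 has the factor \<open>\<phi> 1\<close>.\<close>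

lemma phi_1_pos:
  assumes "all_sizes b \<phi> \<psi>"
  shows "\<phi> 1 > 0"
proof (rule ccontr)
  assume "\<not> \<phi> 1 > 0"
  then have "\<phi> 1 = 0" using phi_nonneg[of 1] by simp
  let ?T = "Node [1..<Suc b] []"
  have wf: "wf_btree b ?T" using b_pos by (simp del: upt_Suc)
  obtain K where "weight (grow b (Suc b) ?T [] 0) = K * grown_weight b \<phi> \<psi> ?T []"
    using tree_weight_grow[OF wf Nil_in_vertices] by (metis le0)
  then have "weight (grow b (Suc b) ?T [] 0) = 0"
    using \<open>\<phi> 1 = 0\<close> by (simp add: grown_weight_def del: upt_Suc)
  then have "total (Suc b) = 0"
    unfolding total_weight_def sum_bucket_trees_Suc[OF b_pos b_pos] bucket_trees_small[OF b_pos order.refl]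
    by (simp add: vertices_Node del: upt_Suc)
  then show False using assms by (metis all_sizes_def le_add1 less_irrefl plus_1_eq_Suc)
qed

end

text \<open>In the following trees the labels in depth-first order are consecutive, starting at
  \<open>off + 1\<close>. The chain has \<open>m\<close> saturated nodes above a leaf of capacity \<open>c\<close>; the star has leaves
  of capacities \<open>cs\<close> below its root.\<close>

definition leaf :: "nat \<Rightarrow> nat \<Rightarrow> btree" where
  "leaf off c = Node [Suc off..<Suc off + c] []"

primrec chain :: "nat \<Rightarrow> nat \<Rightarrow> nat \<Rightarrow> nat \<Rightarrow> btree" where
  "chain b off 0 c = leaf off c"
| "chain b off (Suc m) c = Node [Suc off..<Suc off + b] [chain b (off + b) m c]"

primrec leaves :: "nat \<Rightarrow> nat list \<Rightarrow> btree list" where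
  "leaves off [] = []"
| "leaves off (c # cs) = leaf off c # leaves (off + c) cs"

definition star :: "nat \<Rightarrow> nat list \<Rightarrow> btree" where
  "star b cs = Node [Suc 0..<Suc 0 + b] (leaves b cs)"

lemma labels_leaf: "labels (leaf off c) = [Suc off..<Suc off + c]"
  by (simp add: leaf_def del: upt_Suc)

lemma labels_chain: "labels (chain b off m c) = [Suc off..<Suc off + m * b + c]"
proof (induction m arbitrary: off)
  case (Suc m)
  have "[Suc off..<Suc off + b] @ [Suc off + b..<Suc off + b + (m * b + c)] = [Suc off..<Suc off + b + (m * b + c)]"
    by (rule upt_add_eq_append[symmetric]) simp
  then show ?case using Suc by (simp add: add_ac del: upt_Suc)
qed (simp add: labels_leaf del: upt_Suc)

lemma labels_leaves: "concat (map labels (leaves off cs)) = [Suc off..<Suc off + sum_list cs]"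
proof (induction cs arbitrary: off)
  case (Cons c cs)
  have "[Suc off..<Suc off + c] @ [Suc off + c..<Suc off + c + sum_list cs] = [Suc off..<Suc off + c + sum_list cs]"
    by (rule upt_add_eq_append[symmetric]) simp
  then show ?case using Cons by (simp add: add_ac labels_leaf del: upt_Suc)
qed simp

lemma labels_star: "labels (star b cs) = [1..<Suc (b + sum_list cs)]"
proof -
  have "[Suc 0..<Suc 0 + b] @ [Suc 0 + b..<Suc 0 + b + sum_list cs] = [Suc 0..<Suc 0 + b + sum_list cs]"
    by (rule upt_add_eq_append[symmetric]) simp
  then show ?thesis by (simp add: star_def labels_leaves del: upt_Suc)
qed

lemma wf_btree_leaf: "1 \<le> c \<Longrightarrow> c \<le> b \<Longrightarrow> wf_btree b (leaf off c)"
  by (simp add: leaf_def del: upt_Suc)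

lemma bucket_chain: "y \<in> set (bucket (chain b off m c)) \<Longrightarrow> off < y"
  by (cases m) (auto simp: leaf_def simp del: upt_Suc)

lemma wf_btree_chain:
  assumes "1 \<le> c" "c \<le> b"
  shows "wf_btree b (chain b off m c)"
proof (induction m arbitrary: off)
  case 0
  then show ?case using assms by (simp add: wf_btree_leaf)
next
  case (Suc m)
  have "b \<ge> 1" using assms by simp
  then show ?case using Suc[of "off + b"] by (auto dest!: bucket_chain simp del: upt_Suc)
qed

lemma wf_btree_leaves:
  assumes "\<forall>c\<in>set cs. 1 \<le> c \<and> c \<le> b" "t \<in> set (leaves off cs)"
  shows "wf_btree b t \<and> (\<forall>y\<in>set (bucket t). off < y)"
  using assms
proof (induction cs arbitrary: off)
  case (Cons c cs)
  show ?case
  proof (cases "t = leaf off c")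
    case True
    then show ?thesis using Cons.prems(1)
      by (auto simp: wf_btree_leaf) (auto simp: leaf_def simp del: upt_Suc)
  next
    case False
    then have "wf_btree b t \<and> (\<forall>y\<in>set (bucket t). off + c < y)"
      using Cons.prems by (intro Cons.IH) auto
    then show ?thesis by auto
  qed
qed simp

lemma length_leaves [simp]: "length (leaves off cs) = length cs"
  by (induction cs arbitrary: off) auto

lemma wf_btree_star:
  assumes "b \<ge> 1" "\<forall>c\<in>set cs. 1 \<le> c \<and> c \<le> b"
  shows "wf_btree b (star b cs)"
  using wf_btree_leaves[OF assms(2), of _ b] assms(1)
  by (fastforce simp: star_def simp del: upt_Suc)

lemma set_upt_1: "set [1..<Suc n] = {1..n}"
  by (simp only: set_upt atLeastLessThanSuc_atLeastAtMost)

lemma chain_in_bucket_trees: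
  assumes "1 \<le> c" "c \<le> b"
  shows "chain b 0 m c \<in> bucket_trees b (m * b + c)"
  using wf_btree_chain[OF assms] set_upt_1[of "m * b + c"]
  by (simp add: in_bucket_trees_iff labels_chain del: upt_Suc)

lemma star_in_bucket_trees:
  assumes "b \<ge> 1" "\<forall>c\<in>set cs. 1 \<le> c \<and> c \<le> b"
  shows "star b cs \<in> bucket_trees b (b + sum_list cs)"
  using wf_btree_star[OF assms] set_upt_1[of "b + sum_list cs"]
  by (simp add: in_bucket_trees_iff labels_star del: upt_Suc)

context bucket_weights
begin

lemma weight_leaf: "weight (leaf off c) = \<Psi> c"
  by (simp add: leaf_def tree_weight_leaf del: upt_Suc)

lemma weight_chain: "weight (chain b off m c) = \<phi> 1 ^ m * \<Psi> c"
  by (induction m arbitrary: off) (simp_all add: weight_leaf tree_weight_Node[of b] del: upt_Suc)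

lemma weight_leaves: "prod_list (map weight (leaves off cs)) = prod_list (map \<Psi> cs)"
  by (induction cs arbitrary: off) (simp_all add: weight_leaf)

lemma weight_star: "weight (star b cs) = \<phi> (length cs) * prod_list (map \<Psi> cs)"
  by (simp add: star_def tree_weight_Node weight_leaves del: upt_Suc)

abbreviation rate :: "nat \<Rightarrow> nat \<Rightarrow> real" where "rate \<equiv> node_rate b \<phi> \<psi>"

lemma balance_sum_leaf:
  assumes "1 \<le> c" "c \<le> b"
  shows "balance_sum b \<phi> \<psi> (leaf off c) = rate c 0"
  using wf_btree_leaf[OF assms] by (simp add: leaf_def balance_sum_Node del: upt_Suc)

lemma balance_sum_chain:
  assumes "1 \<le> c" "c \<le> b"
  shows "balance_sum b \<phi> \<psi> (chain b off m c) = real m * rate b 1 + rate c 0"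
proof (induction m arbitrary: off)
  case 0
  then show ?case using balance_sum_leaf[OF assms] by simp
next
  case (Suc m)
  then show ?case using wf_btree_chain[OF assms, of off "Suc m"]
    by (simp add: balance_sum_Node algebra_simps del: upt_Suc wf_btree.simps)
qed

lemma balance_sum_star:
  assumes "\<forall>c\<in>set cs. 1 \<le> c \<and> c \<le> b"
  shows "balance_sum b \<phi> \<psi> (star b cs) = rate b (length cs) + sum_list (map (\<lambda>c. rate c 0) cs)"
proof -
  have "sum_list (map (balance_sum b \<phi> \<psi>) (leaves off cs)) = sum_list (map (\<lambda>c. rate c 0) cs)" for off
    using assms by (induction cs arbitrary: off) (simp_all add: balance_sum_leaf)
  then show ?thesis using wf_btree_star[OF b_pos assms]
    by (simp add: star_def balance_sum_Node del: upt_Suc wf_btree.simps)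
qed

text \<open>Balance equates the sums of trees of equal size. A star with \<open>k\<close> saturated
  leaves against a chain of k + 1 saturated nodes makes the rates \<open>r\<close> affine on the
  support of \<open>\<phi>\<close>. Shifting a label between the two leaves of a star gives the leaf
  rates \<open>s\<close> constant increments. A star with two leaves of capacity 1 against a chain
  links the two sequences.\<close>

lemma affine_if_balanced:
  assumes bal: "balanced b \<phi> \<psi>" and ex: "\<exists>k\<ge>2. \<phi> k > 0"
  obtains \<alpha> \<beta> where "affine_weights b \<phi> \<psi> \<alpha> \<beta>" "\<alpha> > 0" "\<alpha> + \<beta> > 0"
proof -
  obtain C where C: "\<And>n T. n \<ge> 1 \<Longrightarrow> T \<in> family b \<phi> \<psi> n \<Longrightarrow> balance_sum b \<phi> \<psi> T = C n"
    and all: "all_sizes b \<phi> \<psi>"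
    using bal unfolding balanced_def by metis
  note \<Psi>_pos = psi_ext_pos[OF all]
  define r where "r k = rate b k" for k
  define s where "s c = rate c 0" for c
  have r: "r k = real (k + 1) * \<Psi> 1 * (\<phi> (k + 1) / \<phi> k)" for k
    by (simp add: r_def node_rate_def)
  have r_nonneg: "r k \<ge> 0" for k
    using phi_nonneg \<Psi>_pos[of 1] b_pos by (simp add: r)
  have sb: "s b = r 0" by (simp add: r_def s_def)
  have C_chain: "C (m * b + c) = real m * r 1 + s c" if "1 \<le> c" "c \<le> b" for m c
  proof -
    have "chain b 0 m c \<in> family b \<phi> \<psi> (m * b + c)"
      using chain_in_bucket_trees[OF that] \<Psi>_pos[OF that] phi_1_pos[OF all]
      by (simp add: family_def weight_chain)
    from C[OF _ this] show ?thesis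
      using that by (simp add: balance_sum_chain r_def s_def)
  qed
  have C_star: "C (b + sum_list cs) = r (length cs) + sum_list (map s cs)"
    if "\<phi> (length cs) > 0" "\<forall>c\<in>set cs. 1 \<le> c \<and> c \<le> b" for cs
  proof -
    have "prod_list (map \<Psi> cs) > 0"
      using that(2) \<Psi>_pos by (induction cs) auto
    then have "star b cs \<in> family b \<phi> \<psi> (b + sum_list cs)"
      using star_in_bucket_trees[OF b_pos that(2)] that(1) by (simp add: family_def weight_star)
    from C[OF _ this] show ?thesis
      using that b_pos by (simp add: balance_sum_star r_def s_def[abs_def])
  qed
  have r_star: "r k + real k * r 0 = real k * r 1 + r 0" if "\<phi> k > 0" for k
    using C_star[of "replicate k b"] C_chain[of b k] that b_pos sb
    by (simp add: sum_list_replicate add.commute)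
  have r0: "r 0 > 0"
    using \<Psi>_pos[of 1] b_pos phi_0_pos phi_1_pos[OF all] by (simp add: r)
  \<comment> \<open>Here chains must be excluded: with \<open>r 1 = 0\<close> the relation
    \<open>r_star\<close> at some k \<ge> 2 would make \<open>r k\<close> negative. Positivity gives
    \<open>\<phi> 2 > 0\<close>, so that stars with two leaves are available.\<close>
  have r1: "r 1 > 0"
  proof (rule ccontr)
    assume "\<not> r 1 > 0"
    then have "r 1 = 0" using r_nonneg[of 1] by simp
    obtain k where k: "k \<ge> 2" "\<phi> k > 0" using ex by auto
    have "r k + real k * r 0 = r 0" using r_star[OF k(2)] \<open>r 1 = 0\<close> by simp
    moreover have "real k * r 0 \<ge> 2 * r 0" using k(1) r0 by simp
    ultimately show False using r_nonneg[of k] r0 by linarith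
  qed
  then have phi2: "\<phi> 2 > 0"
    using phi_nonneg[of 2] unfolding r by (auto simp: less_le numeral_2_eq_2)
  \<comment> \<open>Forced by affine growth, which makes \<open>r k\<close> equal to \<open>\<alpha> b + \<beta> - \<beta> k\<close>.\<close>
  define \<alpha> where "\<alpha> = r 1 / real b"
  define \<beta> where "\<beta> = r 0 - r 1"
  have \<alpha>b: "\<alpha> * real b = r 1" using b_pos by (simp add: \<alpha>_def)
  have rk: "r k = \<alpha> * real b + \<beta> - \<beta> * real k" if "\<phi> k > 0" for k
    using r_star[OF that] by (simp add: \<alpha>b \<beta>_def algebra_simps)
  have s: "s c = \<alpha> * real c + \<beta>" if "1 \<le> c" "c \<le> b" for c
  proof (cases "b = 1")
    case True
    then show ?thesis using that sb \<alpha>b by (simp add: \<beta>_def)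
  next
    case False
    then have b2: "b \<ge> 2" using b_pos by simp
    define \<delta> where "\<delta> = s 2 - s 1"
    have step: "s (Suc i) = s i + \<delta>" if "1 \<le> i" "i < b" for i
      using C_star[of "[Suc i, 1]"] C_star[of "[i, 2]"] that b2 phi2
      by (simp add: \<delta>_def numeral_2_eq_2)
    have lin: "s c = s 1 + (real c - 1) * \<delta>" if "1 \<le> c" "c \<le> b" for c
      using that
    proof (induction c rule: dec_induct)
      case (step i)
      then show ?case using \<open>\<And>i. 1 \<le> i \<Longrightarrow> i < b \<Longrightarrow> s (Suc i) = s i + \<delta>\<close>[of i]
        by (simp add: algebra_simps)
    qed simp
    have "r 2 + 2 * s 1 = r 1 + s 2"
      using C_star[of "[1, 1]"] C_chain[of 2 1] b2 phi2 by (simp add: numeral_2_eq_2)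
    moreover have "r 2 = 2 * r 1 - r 0" using r_star[OF phi2] by simp
    ultimately have s1: "s 1 = \<delta> + \<beta>" by (simp add: \<delta>_def \<beta>_def)
    \<comment> \<open>At capacity \<open>b\<close> a leaf is a saturated node of out-degree 0, so
      \<open>s b = r 0\<close>; this identifies the increment \<open>\<delta>\<close> with
      \<open>\<alpha>\<close>.\<close>
    have "r 0 = s 1 + (real b - 1) * \<delta>" using lin[of b] sb b_pos by simp
    then have "\<delta> * real b = \<alpha> * real b" using s1 unfolding \<alpha>b by (simp add: \<beta>_def algebra_simps)
    then have "\<delta> = \<alpha>" using b_pos by auto
    then show ?thesis using lin[OF that] s1 by (simp add: algebra_simps)
  qed
  \<comment> \<open>The support has no gap: if it first breaks off after \<open>i\<close>, then
    \<open>r i = 0\<close>, so \<open>\<beta> * i = r 0 > 0\<close> and the affine formula is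
    negative at larger indices, where rates are nonnegative.\<close>
  have supp: "\<phi> (k + 1) = 0" if "\<phi> k = 0" for k
  proof (rule ccontr)
    assume "\<phi> (k + 1) \<noteq> 0"
    then have pos: "\<phi> (k + 1) > 0" using phi_nonneg[of "k + 1"] by simp
    define m where "m = (LEAST i. \<phi> i = 0)"
    have m: "\<phi> m = 0" "m \<le> k" using that by (auto simp: m_def intro: LeastI Least_le)
    then obtain i where i: "m = Suc i" using phi_0_pos by (cases m) auto
    have "\<phi> i \<noteq> 0" using i not_less_Least[of i "\<lambda>i. \<phi> i = 0"] by (simp add: m_def)
    then have "\<phi> i > 0" using phi_nonneg[of i] by simp
    then have "\<beta> * real i = r 0" using rk[of i] m(1) i rk[OF phi_0_pos] r[of i] by simp
    then have "\<beta> > 0" using r0 by (metis mult_nonpos_nonneg not_le of_nat_0_le_iff)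
    then have "\<beta> * real (k + 1) > \<beta> * real i" using m(2) i by simp
    then have "r (k + 1) < 0" using rk[OF pos] rk[OF phi_0_pos] \<open>\<beta> * real i = r 0\<close> by simp
    then show False using r_nonneg[of "k + 1"] by simp
  qed
  have "affine_weights b \<phi> \<psi> \<alpha> \<beta>"
    unfolding affine_weights_def
  proof (intro conjI ballI allI)
    fix k assume k: "k \<in> {1..<b}"
    then have "s k = \<Psi> (k + 1) / \<Psi> k" by (simp add: s_def node_rate_def)
    then show "\<Psi> (k + 1) = \<Psi> k * (\<alpha> * real k + \<beta>)"
      using s[of k] \<Psi>_pos[of k] k by (simp add: field_simps)
  next
    fix k
    show "\<phi> (k + 1) * real (k + 1) * \<Psi> 1 = \<phi> k * (\<alpha> * real b + \<beta> - \<beta> * real k)"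
    proof (cases "\<phi> k = 0")
      case True
      then show ?thesis using supp by simp
    next
      case False
      then have "\<phi> k > 0" using phi_nonneg[of k] by simp
      from rk[OF this, symmetric] show ?thesis using False by (simp add: r)
    qed
  qed
  moreover have "\<alpha> > 0" using r1 b_pos by (simp add: \<alpha>_def)
  moreover have "s 1 > 0"
    using r0 sb \<Psi>_pos[of 1] \<Psi>_pos[of 2] b_pos
    by (cases "b = 1") (auto simp: s_def node_rate_def numeral_2_eq_2)
  then have "\<alpha> + \<beta> > 0" using s[of 1] b_pos by simp
  ultimately show ?thesis using that by blast
qed

end

section \<open>Total weights determine the weights\<close>

context bucket_weights
begin

text \<open>A node of out-degree j has at least b + j labels in its subtree, so out-degrees from
  \<open>k\<close> on do not occur in such a tree.\<close>

lemma tree_weight_cong_small: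
  assumes "wf_btree b T" "tree_size T < b + k" "\<And>j. j < k \<Longrightarrow> \<phi>' j = \<phi> j"
  shows "tree_weight b \<phi>' \<psi> T = weight T"
  using assms(1,2)
proof (induction T)
  case (Node ls ts)
  have "tree_weight b \<phi>' \<psi> t = weight t" if "t \<in> set ts" for t
  proof (rule Node.IH[OF that])
    show "wf_btree b t" using Node.prems(1) that by simp
    have "tree_size t \<le> sum_list (map tree_size ts)"
      using that by (intro member_le_sum_list) auto
    then show "tree_size t < b + k" using Node.prems(2) by (simp add: tree_size_Node)
  qed
  moreover have "length ls = b \<Longrightarrow> length ts < k"
    using Node.prems length_le_sum_tree_size[of ts b] by (simp add: tree_size_Node)
  ultimately show ?case
    using assms(3) by (simp add: tree_weight_Node cong: map_cong)
qed

text \<open>The sequence \<open>\<phi>'\<close> is an arbitrary real one: the candidate to which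
  this is applied has no known sign before it is identified with \<open>\<phi>\<close>.\<close>

lemma phi_eq_if_total_eq:
  assumes all: "all_sizes b \<phi> \<psi>"
    and tot: "\<And>n. n \<ge> 1 \<Longrightarrow> total_weight b \<phi>' \<psi> n = total n"
  shows "\<phi>' k = \<phi> k"
proof (induction k rule: less_induct)
  case (less k)
  show ?case
  proof (cases "k = 0")
    case True
    then show ?thesis
      using tot[OF b_pos] b_pos total_weight_small[of b b] by (simp add: psi_ext_def)
  next
    case False
    define D where "D = {T \<in> bucket_trees b (b + k). length (children T) = k}"
    define P where "P T = prod_list (map weight (children T))" for T
    have eq: "tree_weight b \<phi>' \<psi> T - weight T = (if T \<in> D then (\<phi>' k - \<phi> k) * P T else 0)"
      if T: "T \<in> bucket_trees b (b + k)" for T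
    proof -
      obtain ls ts where N: "T = Node ls ts" by (cases T)
      have wf: "wf_btree b (Node ls ts)" and size: "length ls + sum_list (map tree_size ts) = b + k"
        using T bucket_tree_size[OF T] by (auto simp: N in_bucket_trees_iff tree_size_Node)
      have len: "length ts \<le> sum_list (map tree_size ts)"
        using wf by (intro length_le_sum_tree_size[of _ b]) simp
      have sat: "length ls = b" using wf size False by (cases "ts = []") auto
      have child: "tree_weight b \<phi>' \<psi> t = weight t" if "t \<in> set ts" for t
      proof (rule tree_weight_cong_small)
        show "wf_btree b t" using wf that by simp
        have "tree_size t \<le> sum_list (map tree_size ts)"
          using that by (intro member_le_sum_list) auto
        then show "tree_size t < b + k" using size sat b_pos by simp
      qed (rule less)
      have "tree_weight b \<phi>' \<psi> T - weight T = (\<phi>' (length ts) - \<phi> (length ts)) * P T"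
        using child sat by (simp add: N P_def tree_weight_Node algebra_simps cong: map_cong)
      moreover have "length ts < k" if "T \<notin> D"
        using that T len size sat by (simp add: N D_def)
      ultimately show ?thesis using less by (auto simp: N D_def)
    qed
    have D: "finite D" "D \<subseteq> bucket_trees b (b + k)"
      using b_pos by (auto simp: D_def)
    have "total_weight b \<phi>' \<psi> (b + k) - total (b + k) =
        (\<Sum>T\<in>bucket_trees b (b + k). if T \<in> D then (\<phi>' k - \<phi> k) * P T else 0)"
      unfolding total_weight_def sum_subtractf[symmetric] using eq by simp
    also have "\<dots> = (\<phi>' k - \<phi> k) * (\<Sum>T\<in>D. P T)"
      using D b_pos by (simp add: sum.inter_restrict[symmetric] Int_absorb1 sum_distrib_left)
    finally have "(\<phi>' k - \<phi> k) * (\<Sum>T\<in>D. P T) = 0"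
      using tot[of "b + k"] b_pos by simp
    moreover have "(\<Sum>T\<in>D. P T) > 0"
    \<comment> \<open>The coefficient is positive because of the star with \<open>k\<close> leaves
      of capacity 1, which has exactly b + k labels.\<close>
    proof (rule sum_pos2[OF D(1)])
      show "star b (replicate k 1) \<in> D"
        using star_in_bucket_trees[OF b_pos, of "replicate k 1"] b_pos
        by (simp add: D_def sum_list_replicate) (simp add: star_def)
      have "\<Psi> 1 > 0" using psi_ext_pos[OF all, of 1] b_pos by simp
      then show "P (star b (replicate k 1)) > 0"
        by (simp add: P_def star_def weight_leaves)
      show "P T \<ge> 0" if "T \<in> D" for T
        unfolding P_def using that
        by (intro prod_list_nonneg) (auto simp: D_def in_bucket_trees_iff intro!: weight_nonneg dest: wf_btree_children)
    qed
    ultimately show ?thesis by simp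
  qed
qed

lemma affine_if_affine_ratio:
  assumes ar: "affine_ratio b \<phi> \<psi>" and ex: "\<exists>k\<ge>2. \<phi> k > 0"
  obtains \<alpha> \<beta> where "affine_weights b \<phi> \<psi> \<alpha> \<beta>" "\<alpha> > 0" "\<alpha> + \<beta> > 0"
proof -
  obtain \<alpha> \<beta> where all: "all_sizes b \<phi> \<psi>"
    and ratio: "\<And>n. n \<ge> 1 \<Longrightarrow> total (n + 1) / total n = \<alpha> * real n + \<beta>"
    using ar by (auto simp: affine_ratio_def)
  have tot_pos: "total n > 0" if "n \<ge> 1" for n using all that by (simp add: all_sizes_def)
  have rec: "total (Suc n) = total n * (\<alpha> * real n + \<beta>)" if "n \<ge> 1" for n
    using ratio[OF that] tot_pos[OF that] by (simp add: field_simps)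
  have pos: "\<alpha> * real n + \<beta> > 0" if "n \<ge> 1" for n
    using ratio[OF that] tot_pos[of n] tot_pos[of "n + 1"] that
    by (metis le_add2 zero_less_divide_iff)
  have \<Psi>1: "\<Psi> 1 > 0" using psi_ext_pos[OF all, of 1] b_pos by simp
  \<comment> \<open>The solution of the out-degree recursion in \<open>affine_weights\<close>
    starting from \<open>\<phi> 0\<close>. The bucket weights need no replacement: up to size
    \<open>b\<close> they are the total weights themselves.\<close>
  define \<phi>' where "\<phi>' k = \<phi> 0 * (\<Prod>i<k. (\<alpha> * real b + \<beta> - \<beta> * real i) / (real (i + 1) * \<Psi> 1))" for k
  have \<Psi>': "psi_ext b \<phi>' \<psi> = \<Psi>" by (simp add: fun_eq_iff psi_ext_def \<phi>'_def)
  have aff': "affine_weights b \<phi>' \<psi> \<alpha> \<beta>"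
    unfolding affine_weights_def \<Psi>'
  proof (intro conjI ballI allI)
    fix k assume "k \<in> {1..<b}"
    then show "\<Psi> (k + 1) = \<Psi> k * (\<alpha> * real k + \<beta>)"
      using rec[of k] total_weight_small[of k b] total_weight_small[of "k + 1" b] by simp
  next
    fix k
    show "\<phi>' (k + 1) * real (k + 1) * \<Psi> 1 = \<phi>' k * (\<alpha> * real b + \<beta> - \<beta> * real k)"
      using \<Psi>1 by (simp add: \<phi>'_def field_simps del: of_nat_Suc)
  qed
  have "total_weight b \<phi>' \<psi> n = total n" if "n \<ge> 1" for n
    using that
  proof (induction n rule: dec_induct)
    case base
    then show ?case using total_weight_small[of 1 b] b_pos \<Psi>' by simp
  next
    case (step n)
    then show ?case using total_weight_Suc_affine[OF aff' b_pos] rec by simp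
  qed
  then have "\<phi>' = \<phi>" using phi_eq_if_total_eq[OF all] by blast
  then have aff: "affine_weights b \<phi> \<psi> \<alpha> \<beta>" using aff' by simp
  \<comment> \<open>A negative slope makes the ratio negative for large sizes; slope zero makes
    \<open>\<phi> 2\<close> and then all later weights vanish, leaving only chains.\<close>
  have "\<alpha> > 0"
  proof (rule ccontr)
    assume "\<not> \<alpha> > 0"
    moreover have "\<not> \<alpha> < 0"
    proof
      assume "\<alpha> < 0"
      obtain n :: nat where n: "real n > \<beta> / (- \<alpha>)" using reals_Archimedean2 by blast
      then have "real n * (- \<alpha>) > \<beta>" using \<open>\<alpha> < 0\<close> by (simp add: field_simps)
      then have "\<alpha> * real (Suc n) + \<beta> < 0" using \<open>\<alpha> < 0\<close> by (simp add: algebra_simps)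
      then show False using pos[of "Suc n"] by simp
    qed
    ultimately have "\<alpha> = 0" by simp
    have "\<phi> k = 0" if "k \<ge> 2" for k
      using that
    proof (induction k rule: dec_induct)
      case base
      have "\<phi> (1 + 1) * real (1 + 1) * \<Psi> 1 = \<phi> 1 * (\<alpha> * real b + \<beta> - \<beta> * real 1)"
        using aff unfolding affine_weights_def by blast
      then show ?case using \<open>\<alpha> = 0\<close> \<Psi>1 by (simp add: numeral_2_eq_2)
    next
      case (step k)
      have "\<phi> (k + 1) * real (k + 1) * \<Psi> 1 = \<phi> k * (\<alpha> * real b + \<beta> - \<beta> * real k)"
        using aff unfolding affine_weights_def by blast
      then show ?case using step \<Psi>1 by simp
    qed
    then show False using ex by force
  qed
  moreover have "\<alpha> + \<beta> > 0" using pos[of 1] by simp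
  ultimately show ?thesis using aff that by blast
qed

end

section \<open>The three models\<close>

text \<open>The models have affine growth with \<open>\<alpha> = slope M\<close> and \<open>\<beta> = offset M\<close>.\<close>

primrec slope :: "model \<Rightarrow> real" where
  "slope Bucket_Recursive = 1"
| "slope (Ary d) = d - 1"
| "slope (Plane_Oriented \<alpha>) = \<alpha> + 1"

primrec offset :: "model \<Rightarrow> real" where
  "offset Bucket_Recursive = 0"
| "offset (Ary d) = 1"
| "offset (Plane_Oriented \<alpha>) = - 1"

lemma attraction_eq:
  "attraction M n T v = attract (slope M) (offset M) T v / (slope M * real n + offset M)"
  by (cases M) (simp_all add: attract_def algebra_simps)

text \<open>Attraction depends only on the ratio of the two parameters. The free factor
  \<open>c\<close> is the scaling parameter \<open>a\<close> of the weights.\<close>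

lemma attraction_eq_scaled:
  assumes "c \<noteq> 0"
  shows "attraction M n T v =
    attract (c * slope M) (c * offset M) T v / (c * slope M * real n + c * offset M)"
proof -
  have "attract (c * slope M) (c * offset M) T v = c * attract (slope M) (offset M) T v"
    "c * slope M * real n + c * offset M = c * (slope M * real n + offset M)"
    by (simp_all add: attract_def algebra_simps)
  then show ?thesis using assms by (simp add: attraction_eq)
qed

lemma gbinomial_add_self: "(real k + x) gchoose k = pochhammer (x + 1) k / fact k"
  by (simp add: gbinomial_pochhammer' add.commute)

text \<open>The closed formula is the product of the numbers A i + B for i = 1, ..., k in disguise,
  which is the shape in which the growth law produces bucket weights.\<close>

lemma shifted_gbinomial_rec:
  assumes "A \<noteq> (0::real)"
  shows "fact (Suc k) * A ^ Suc k * ((real (Suc k) + B / A) gchoose Suc k) =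
    fact k * A ^ k * ((real k + B / A) gchoose k) * (A * real (Suc k) + B)"
proof -
  have *: "fact m * A ^ m * ((real m + B / A) gchoose m) = A ^ m * pochhammer (B / A + 1) m" for m
    unfolding gbinomial_add_self by simp
  show ?thesis
    unfolding * using assms by (simp add: pochhammer_rec' field_simps)
qed

lemma model_psi_1: "model_psi M 1 = 1"
  by (cases M) simp_all

lemma model_psi_Suc:
  assumes "slope M \<noteq> 0" "k \<ge> 1"
  shows "model_psi M (Suc k) = model_psi M k * (slope M * real k + offset M)"
proof -
  obtain j where k: "k = Suc j" using assms(2) by (cases k) auto
  show ?thesis
  proof (cases M)
    case Bucket_Recursive
    then show ?thesis by (simp add: k)
  next
    case (Ary d)
    then show ?thesis
      using shifted_gbinomial_rec[of "d - 1" j 1] assms(1) by (simp add: k del: fact_Suc power_Suc)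
  next
    case (Plane_Oriented a)
    then show ?thesis
      using shifted_gbinomial_rec[of "a + 1" j "- 1"] assms(1)
      by (simp add: k del: fact_Suc power_Suc)
  qed
qed

lemma model_phi_0: "model_phi b M 0 = model_psi M b"
  by (cases M) simp_all

lemma model_phi_Suc:
  "model_phi b M (Suc k) * real (Suc k) = model_phi b M k * (slope M * real b + offset M - offset M * real k)"
proof (cases M)
  case Bucket_Recursive
  then show ?thesis by (simp add: field_simps del: of_nat_Suc)
next
  case (Ary d)
  let ?z = "real b * (d - 1) + 1"
  have "(?z gchoose Suc k) * real (Suc k) = (?z gchoose k) * (?z - real k)"
    using gbinomial_mult_1[of ?z k] by (simp add: algebra_simps)
  then show ?thesis using Ary by (simp add: mult.assoc mult.commute[of "real b"] del: of_nat_Suc)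
next
  case (Plane_Oriented a)
  let ?z = "(a + 1) * real b - 2"
  have "((?z + real (Suc k)) gchoose Suc k) * real (Suc k) = ((?z + real k) gchoose k) * (?z + 1 + real k)"
    unfolding add.commute[of ?z "real _"] gbinomial_add_self
    by (simp add: pochhammer_rec' field_simps del: of_nat_Suc)
  then show ?thesis using Plane_Oriented by (simp add: mult.assoc del: of_nat_Suc)
qed

text \<open>The slope vanishes for \<open>Ary 1\<close>; there the offset 1 keeps the line
  positive.\<close>

lemma admissible_slope_nonneg:
  assumes "admissible b M" "b \<ge> 1"
  shows "slope M \<ge> 0" "n \<ge> 1 \<Longrightarrow> slope M * real n + offset M > 0"
proof -
  have Ary: "d - 1 \<ge> 0" if "M = Ary d" for d
  proof -
    have "(d - 1) * real b \<ge> 0" using assms that by (auto simp: Nats_def)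
    then show ?thesis using assms(2) by (simp add: zero_le_mult_iff)
  qed
  show *: "slope M \<ge> 0" using assms Ary by (cases M) auto
  assume n: "n \<ge> 1"
  then have "slope M * real n \<ge> slope M" using mult_left_mono[OF _ *, of 1 "real n"] by simp
  moreover have "slope M + offset M > 0" using assms Ary by (cases M) force+
  ultimately show "slope M * real n + offset M > 0" by simp
qed

lemma affine_if_modelled:
  assumes "modelled_by b \<phi> \<psi> M" "slope M \<noteq> 0" "b \<ge> 1"
  obtains c where "c > 0" "affine_weights b \<phi> \<psi> (c * slope M) (c * offset M)" "psi_ext b \<phi> \<psi> 1 > 0"
proof -
  obtain a s where as: "a > 0" "s > 0"
    and phi: "\<And>k. \<phi> k = a ^ b * s powi (int k - 1) * model_phi b M k"
    and psi: "\<And>k. k \<in> {1..<b} \<Longrightarrow> \<psi> k = a ^ k * s powi (-1) * model_psi M k"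
    using assms(1) by (auto simp: modelled_by_def)
  have Psi: "psi_ext b \<phi> \<psi> k = a ^ k / s * model_psi M k" if "1 \<le> k" "k \<le> b" for k
    using psi[of k] phi[of 0] that as
    by (cases "k = b") (simp_all add: psi_ext_def model_phi_0 power_int_minus field_simps)
  have Psi1: "psi_ext b \<phi> \<psi> 1 = a / s" using Psi[of 1] assms(3) model_psi_1 by simp
  have "affine_weights b \<phi> \<psi> (a * slope M) (a * offset M)"
    unfolding affine_weights_def Psi1
  proof (intro conjI ballI allI)
    fix k assume "k \<in> {1..<b}"
    then show "psi_ext b \<phi> \<psi> (k + 1) = psi_ext b \<phi> \<psi> k * (a * slope M * real k + a * offset M)"
      using assms(2) by (simp add: Psi model_psi_Suc algebra_simps)
  next
    fix k
    have "s powi (int (k + 1) - 1) = s powi (int k - 1) * s"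
      using as power_int_add_1[of s "int k - 1"] by simp
    then have "\<phi> (k + 1) * real (k + 1) * (a / s) =
        a ^ b * s powi (int k - 1) * (model_phi b M (Suc k) * real (Suc k)) * a"
      using as by (simp add: phi field_simps del: of_nat_Suc)
    then show "\<phi> (k + 1) * real (k + 1) * (a / s) =
        \<phi> k * (a * slope M * real b + a * offset M - a * offset M * real k)"
      unfolding model_phi_Suc by (simp add: phi algebra_simps)
  qed
  then show ?thesis using that[of a] as Psi1 by simp
qed

lemma modelled_if_affine:
  assumes aff: "affine_weights b \<phi> \<psi> (c * slope M) (c * offset M)"
    and c: "c > 0" and M: "slope M \<noteq> 0" and b: "b \<ge> 1" and pos: "psi_ext b \<phi> \<psi> 1 > 0"
  shows "modelled_by b \<phi> \<psi> M"
proof -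
  \<comment> \<open>Forced by capacity 1: all models have \<open>model_psi M 1 = 1\<close>, which
    scales to c / s.\<close>
  define s where "s = c / psi_ext b \<phi> \<psi> 1"
  have s: "s > 0" "psi_ext b \<phi> \<psi> 1 = c / s" using c pos by (auto simp: s_def)
  have Psi: "psi_ext b \<phi> \<psi> k = c ^ k / s * model_psi M k" if "1 \<le> k" "k \<le> b" for k
    using that
  proof (induction k rule: dec_induct)
    case base
    then show ?case using s model_psi_1 by simp
  next
    case (step k)
    then have "psi_ext b \<phi> \<psi> (Suc k) = psi_ext b \<phi> \<psi> k * (c * slope M * real k + c * offset M)"
      using aff by (simp add: affine_weights_def)
    then show ?case using step M by (simp add: model_psi_Suc algebra_simps)
  qed
  have phi: "\<phi> k = c ^ b * s powi (int k - 1) * model_phi b M k" for k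
  proof (induction k)
    case 0
    then show ?case using Psi[of b] b s(1)
      by (simp add: psi_ext_def model_phi_0 power_int_minus field_simps)
  next
    case (Suc k)
    have "s powi (int (Suc k) - 1) = s powi (int k - 1) * s"
      using s(1) power_int_add_1[of s "int k - 1"] by simp
    then have "c ^ b * s powi (int (Suc k) - 1) * model_phi b M (Suc k) * (real (Suc k) * (c / s)) =
        c ^ b * s powi (int k - 1) * (model_phi b M (Suc k) * real (Suc k)) * c"
      using s(1) by (simp add: field_simps del: of_nat_Suc)
    also have "\<dots> = \<phi> k * (c * slope M * real b + c * offset M - c * offset M * real k)"
      unfolding model_phi_Suc by (simp add: Suc algebra_simps)
    also have "\<dots> = \<phi> (k + 1) * real (k + 1) * psi_ext b \<phi> \<psi> 1"
      using aff unfolding affine_weights_def by (metis (no_types))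
    also have "\<dots> = \<phi> (Suc k) * (real (Suc k) * (c / s))"
      by (simp only: s(2) Suc_eq_plus1 mult.assoc)
    finally show ?case using c s(1) by simp
  qed
  show ?thesis
    unfolding modelled_by_def
  proof (intro exI conjI ballI allI)
    show "\<psi> k = c ^ k * s powi (-1) * model_psi M k" if "k \<in> {1..<b}" for k
      using Psi[of k] that by (simp add: psi_ext_def power_int_minus field_simps)
  qed (use c s(1) phi in auto)
qed

text \<open>Only \<open>Ary 1\<close> has slope zero. For b \<ge> 2 its formulas give the zero
  sequence, against \<open>\<phi> 0 > 0\<close>; for b = 1 they give chains.\<close>

lemma modelled_slope_nonzero:
  assumes "admissible b M" "modelled_by b \<phi> \<psi> M" "b \<ge> 1" "\<phi> 0 > 0" "\<exists>k\<ge>2. \<phi> k > 0"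
  shows "slope M \<noteq> 0"
proof
  assume "slope M = 0"
  then have M: "M = Ary 1" using assms(1) by (cases M) auto
  obtain a s where phi: "\<And>k. \<phi> k = a ^ b * s powi (int k - 1) * model_phi b M k"
    using assms(2) by (auto simp: modelled_by_def)
  have "model_phi b M 0 \<noteq> 0" using phi[of 0] assms(4) by auto
  then have "b = 1" using M assms(3) by (cases "b = 1") auto
  obtain k where k: "k \<ge> 2" "\<phi> k > 0" using assms(5) by auto
  have "((1::real) gchoose k) = 0"
  proof -
    have "1 choose k = 0" using k(1) by (intro binomial_eq_0) simp
    then show ?thesis using binomial_gbinomial[of 1 k, where ?'a = real]
      by (metis of_nat_0 of_nat_1)
  qed
  then have "model_phi b M k = 0" using M \<open>b = 1\<close> by simp
  then show False using phi[of k] k(2) by simp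
qed

text \<open>For \<open>\<beta> > 0\<close> consecutive weights have a ratio proportional to x - k
  with x = \<alpha> b / \<beta> + 1. If \<open>x\<close> were not an integer, the weights would stay
  positive up to its ceiling \<open>m\<close> and turn negative at m + 1. Integrality of
  \<open>x\<close> also makes d = 1 + \<alpha> / \<beta> rational.\<close>

lemma (in bucket_weights) obtain_model:
  assumes aff: "affine_weights b \<phi> \<psi> \<alpha> \<beta>" and pos: "\<alpha> > 0" "\<alpha> + \<beta> > 0" "\<Psi> 1 > 0"
  obtains M c where "admissible b M" "c > 0" "\<alpha> = c * slope M" "\<beta> = c * offset M"
proof -
  consider "\<beta> = 0" | "\<beta> > 0" | "\<beta> < 0" by linarith
  then show ?thesis
  proof cases
    case 1
    then show ?thesis using that[of Bucket_Recursive \<alpha>] pos by simp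
  next
    case 3
    then show ?thesis
      \<comment> \<open>This parameter is positive precisely because
        \<open>\<alpha> + \<beta> > 0\<close>.\<close>
      using that[of "Plane_Oriented (\<alpha> / (- \<beta>) - 1)" "- \<beta>"] pos by (simp add: field_simps)
  next
    case 2
    define x where "x = \<alpha> * real b / \<beta> + 1"
    have x: "\<alpha> * real b + \<beta> - \<beta> * real k = \<beta> * (x - real k)" for k
      using 2 by (simp add: x_def field_simps)
    have rec: "\<phi> (Suc k) * (real (Suc k) * \<Psi> 1) = \<phi> k * (\<beta> * (x - real k))" for k
      using aff unfolding affine_weights_def x by (simp add: mult.assoc)
    have "x \<ge> 1" using 2 pos by (simp add: x_def)
    have "\<alpha> * real b / \<beta> \<in> \<nat>"
    proof (rule ccontr)
      assume notin: "\<alpha> * real b / \<beta> \<notin> \<nat>"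
      define m where "m = nat \<lceil>x\<rceil>"
      have "x \<noteq> real m"
      proof
        assume "x = real m"
        then have "\<alpha> * real b / \<beta> = real (m - 1)"
          using \<open>x \<ge> 1\<close> by (simp add: x_def of_nat_diff)
        then show False using notin by (metis of_nat_in_Nats)
      qed
      then have xm: "x < real m" "real m < x + 1"
        unfolding m_def using \<open>x \<ge> 1\<close> by linarith+
      have "\<phi> k > 0" if "k \<le> m" for k
        using that
      proof (induction k)
        case (Suc k)
        then have "x - real k > 0" using xm by linarith
        then have "\<phi> k * (\<beta> * (x - real k)) > 0" using Suc 2 by simp
        then have "\<phi> (Suc k) * (real (Suc k) * \<Psi> 1) > 0" unfolding rec .
        moreover have "real (Suc k) * \<Psi> 1 > 0" using pos(3) by (intro mult_pos_pos) auto
        ultimately show ?case by (rule zero_less_mult_pos2)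
      qed (use phi_0_pos in simp)
      then have "\<phi> m * (\<beta> * (x - real m)) < 0"
        using 2 xm by (simp add: mult_pos_neg)
      then have "\<phi> (Suc m) * (real (Suc m) * \<Psi> 1) < 0" unfolding rec .
      moreover have "\<phi> (Suc m) * (real (Suc m) * \<Psi> 1) \<ge> 0"
        using phi_nonneg pos(3) by (intro mult_nonneg_nonneg) auto
      ultimately show False by simp
    qed
    moreover have "1 + \<alpha> / \<beta> \<in> \<rat>"
    proof -
      have "\<alpha> * real b / \<beta> \<in> \<rat>"
        using \<open>\<alpha> * real b / \<beta> \<in> \<nat>\<close> Nats_subset_Rats by blast
      then have "1 + (\<alpha> * real b / \<beta>) / real b \<in> \<rat>"
        by (rule Rats_add[OF Rats_1 Rats_divide[OF _ Rats_of_nat]])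
      then show ?thesis using b_pos by simp
    qed
    ultimately show ?thesis
      using that[of "Ary (1 + \<alpha> / \<beta>)" \<beta>] 2 by simp
  qed
qed

text \<open>For \<open>Ary 1\<close> the model weights are junk if \<open>b \<ge> 2\<close>, whereas the following weights generate
  the evolution process of every admissible model.\<close>

definition canonical_psi :: "real \<Rightarrow> real \<Rightarrow> nat \<Rightarrow> real" where
  "canonical_psi A B k = (\<Prod>i\<in>{1..<k}. A * real i + B)"

definition canonical_phi :: "nat \<Rightarrow> real \<Rightarrow> real \<Rightarrow> nat \<Rightarrow> real" where
  "canonical_phi b A B k = canonical_psi A B b * (\<Prod>i<k. (A * real b + B - B * real i) / real (i + 1))"

lemma canonical_psi_ext: "psi_ext b (canonical_phi b A B) (canonical_psi A B) = canonical_psi A B"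
  by (simp add: fun_eq_iff psi_ext_def canonical_phi_def)

lemma affine_canonical:
  "affine_weights b (canonical_phi b A B) (canonical_psi A B) A B"
  unfolding affine_weights_def canonical_psi_ext
  by (simp add: canonical_psi_def canonical_phi_def del: of_nat_Suc)

text \<open>Signs matter only for a positive offset, that is for \<open>Ary d\<close>: as (d - 1) b
  is an integer m, the factor m + 1 - i vanishes at i = m + 1, before any negative factor
  enters.\<close>

lemma bucket_weights_canonical:
  assumes "admissible b M" "b \<ge> 1"
  shows "bucket_weights b (canonical_phi b (slope M) (offset M)) (canonical_psi (slope M) (offset M))"
proof
  have psi: "canonical_psi (slope M) (offset M) k > 0" for k
    unfolding canonical_psi_def using admissible_slope_nonneg(2)[OF assms] by (intro prod_pos) auto
  then show "canonical_psi (slope M) (offset M) k \<ge> 0" for k by (simp add: less_imp_le)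
  show "canonical_phi b (slope M) (offset M) 0 > 0" using psi by (simp add: canonical_phi_def)
  have *: "(\<Prod>i<k. (slope M * real b + offset M - offset M * real i) / real (i + 1)) \<ge> 0" for k
  proof (cases "offset M \<le> 0")
    case True
    have "slope M * real b + offset M - offset M * real i \<ge> 0" for i
      using admissible_slope_nonneg(2)[OF assms, of b] assms(2) mult_nonpos_nonneg[OF True, of "real i"] by simp
    then show ?thesis by (intro prod_nonneg) auto
  next
    case False
    then obtain d where d: "M = Ary d" by (cases M) auto
    obtain m where m: "(d - 1) * real b = real m" using assms(1) d by (auto simp: Nats_def)
    have eq: "slope M * real b + offset M - offset M * real i = real (m + 1) - real i" for i
      using m d by simp
    show ?thesis
    proof (cases "k \<le> m + 1")
      case True
      then show ?thesis unfolding eq by (intro prod_nonneg) auto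
    next
      case False
      then have "(\<Prod>i<k. (slope M * real b + offset M - offset M * real i) / real (i + 1)) = 0"
        unfolding eq by (intro prod_zero) (auto intro!: bexI[of _ "m + 1"])
      then show ?thesis by (simp only: order.refl)
    qed
  qed
  show "canonical_phi b (slope M) (offset M) k \<ge> 0" for k
    unfolding canonical_phi_def using *[of k] psi[of b] by (intro mult_nonneg_nonneg) auto
qed (use assms in simp)

section \<open>Consequences of affine growth, and recovery of the model from its process\<close>

lemma positive_slope_line:
  assumes "(\<alpha>::real) > 0" "\<alpha> + \<beta> > 0" "n \<ge> 1"
  shows "\<alpha> * real n + \<beta> > 0"
proof -
  have "\<alpha> * 1 \<le> \<alpha> * real n" using assms by (intro mult_left_mono) auto
  then show ?thesis using assms(2) by simp
qed

context bucket_weights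
begin

lemma affine_consequences:
  assumes aff: "affine_weights b \<phi> \<psi> \<alpha> \<beta>" and pos: "\<alpha> > 0" "\<alpha> + \<beta> > 0" "\<Psi> 1 > 0"
  shows "combinatorial_model b \<phi> \<psi>" "affine_ratio b \<phi> \<psi>" "evolution_process b \<phi> \<psi>"
    "growth_rule b \<phi> \<psi>" "randomness_preserved b \<phi> \<psi>" "balanced b \<phi> \<psi>"
proof -
  have line: "\<alpha> * real n + \<beta> > 0" if "n \<ge> 1" for n
    using positive_slope_line[OF pos(1,2) that] .
  have all: "all_sizes b \<phi> \<psi>"
    using all_sizes_affine[OF aff b_pos pos(3) line] .
  obtain M c where M: "admissible b M" "c > 0" "\<alpha> = c * slope M" "\<beta> = c * offset M"
    using obtain_model[OF aff pos] .
  have "slope M \<noteq> 0" using M(3) pos(1) by auto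
  then have "modelled_by b \<phi> \<psi> M"
    using modelled_if_affine[OF _ M(2) _ b_pos pos(3)] aff M(3,4) by simp
  then show "combinatorial_model b \<phi> \<psi>" using M(1) by (auto simp: combinatorial_model_def)
  have "generated_by b \<phi> \<psi> M"
    using generated_if_affine[OF aff line all] attraction_eq_scaled[of c M] M(2-4) by simp
  then show "evolution_process b \<phi> \<psi>" using M(1) by (auto simp: evolution_process_def)
  have "total (n + 1) / total n = \<alpha> * real n + \<beta>" if "n \<ge> 1" for n
  proof -
    have "total n > 0" using all that by (simp add: all_sizes_def)
    then show ?thesis using total_weight_Suc_affine[OF aff b_pos that] by simp
  qed
  then show "affine_ratio b \<phi> \<psi>" using all by (auto simp: affine_ratio_def)
  show "growth_rule b \<phi> \<psi>" using growth_rule_if_affine[OF aff line all] .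
  then show "randomness_preserved b \<phi> \<psi>" by (rule preserved_if_growth_rule)
  then show "balanced b \<phi> \<psi>" by (rule balanced_if_preserved)
qed

lemma generated_if_modelled:
  assumes adm: "admissible b M" and mod: "modelled_by b \<phi> \<psi> M" and ex: "\<exists>k\<ge>2. \<phi> k > 0"
  shows "generated_by b \<phi> \<psi> M"
    and "\<exists>\<alpha> \<beta>. affine_weights b \<phi> \<psi> \<alpha> \<beta> \<and> \<alpha> > 0 \<and> \<alpha> + \<beta> > 0 \<and> \<Psi> 1 > 0"
proof -
  have nz: "slope M \<noteq> 0" using modelled_slope_nonzero[OF adm mod b_pos phi_0_pos ex] .
  obtain c where c: "c > 0" "affine_weights b \<phi> \<psi> (c * slope M) (c * offset M)" "\<Psi> 1 > 0"
    using affine_if_modelled[OF mod nz b_pos] .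
  have pos: "c * slope M > 0" "c * slope M + c * offset M > 0"
    using c(1) nz admissible_slope_nonneg(1)[OF adm b_pos] admissible_slope_nonneg(2)[OF adm b_pos, of 1]
    by (simp_all add: less_le flip: distrib_left)
  have line: "c * slope M * real n + c * offset M > 0" if "n \<ge> 1" for n
    using positive_slope_line[OF pos that] .
  have all: "all_sizes b \<phi> \<psi>"
    using all_sizes_affine[OF c(2) b_pos c(3) line] .
  show "generated_by b \<phi> \<psi> M"
    using generated_if_affine[OF c(2) line all] attraction_eq_scaled[of c M] c(1) by simp
  show "\<exists>\<alpha> \<beta>. affine_weights b \<phi> \<psi> \<alpha> \<beta> \<and> \<alpha> > 0 \<and> \<alpha> + \<beta> > 0 \<and> \<Psi> 1 > 0"
    using c(2,3) pos by blast
qed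

text \<open>The first two out-degree equations with \<open>\<Psi> 1\<close> eliminated. The quotient
  of \<open>\<phi> 2 * \<phi> 0\<close> by \<open>\<phi> 1 ^ 2\<close> is invariant under scaling
  and detects the ratio of \<open>\<alpha>\<close> and \<open>\<beta>\<close>.\<close>

lemma affine_phi_relation:
  assumes aff: "affine_weights b \<phi> \<psi> \<alpha> \<beta>" and pos: "\<Psi> 1 > 0"
  shows "2 * \<phi> 2 * \<phi> 0 * (\<alpha> * real b + \<beta>) = \<phi> 1 ^ 2 * (\<alpha> * real b)"
proof -
  have "\<phi> (k + 1) * real (k + 1) * \<Psi> 1 = \<phi> k * (\<alpha> * real b + \<beta> - \<beta> * real k)" for k
    using aff unfolding affine_weights_def by blast
  from this[of 0] this[of 1] have e: "\<phi> 1 * \<Psi> 1 = \<phi> 0 * (\<alpha> * real b + \<beta>)" "2 * \<phi> 2 * \<Psi> 1 = \<phi> 1 * (\<alpha> * real b)"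
    by (simp_all add: numeral_2_eq_2)
  have "2 * \<phi> 2 * \<phi> 0 * (\<alpha> * real b + \<beta>) = (2 * \<phi> 2 * \<Psi> 1) * \<phi> 1"
    using e(1) by (simp add: mult_ac)
  also have "\<dots> = \<phi> 1 ^ 2 * (\<alpha> * real b)"
    unfolding e(2) by (simp add: power2_eq_square)
  finally show ?thesis .
qed

text \<open>The random tree of size \<open>2 b + 1\<close> already determines the ratio of \<open>\<alpha>\<close> and \<open>\<beta>\<close>: compare
  the chain with the tree whose root has one saturated child and one child of capacity 1.\<close>

lemma modelled_if_generated:
  assumes adm: "admissible b M" and gen: "generated_by b \<phi> \<psi> M" and ex: "\<exists>k\<ge>2. \<phi> k > 0"
  shows "modelled_by b \<phi> \<psi> M"
proof -
  let ?A = "slope M" and ?B = "offset M"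
  let ?\<phi> = "canonical_phi b ?A ?B" and ?\<psi> = "canonical_psi ?A ?B"
  interpret can: bucket_weights b ?\<phi> ?\<psi>
    by (rule bucket_weights_canonical[OF adm b_pos])
  have line: "?A * real n + ?B > 0" if "n \<ge> 1" for n
    using admissible_slope_nonneg(2)[OF adm b_pos that] .
  have \<Psi>c: "can.\<Psi> 1 = 1" by (simp add: canonical_psi_ext canonical_psi_def)
  have allc: "all_sizes b ?\<phi> ?\<psi>"
    using all_sizes_affine[OF affine_canonical b_pos _ line] \<Psi>c by simp
  have genc: "generated_by b ?\<phi> ?\<psi> M"
    using can.generated_if_affine[OF affine_canonical line allc] attraction_eq by simp
  have all: "all_sizes b \<phi> \<psi>" using gen by (simp add: generated_by_def)
  \<comment> \<open>Both weight sequences generate the process of \<open>M\<close>, so their random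
    trees agree although the weights need not.\<close>
  have same: "rtree n = can.rtree n" if "n \<ge> 1" for n
    using gen genc that by (cases n) (auto simp: generated_by_def)
  have "randomness_preserved b ?\<phi> ?\<psi>"
    by (intro can.preserved_if_growth_rule can.growth_rule_if_affine[OF affine_canonical line allc])
  then have "randomness_preserved b \<phi> \<psi>"
    using all same by (auto simp: randomness_preserved_def)
  then obtain \<alpha> \<beta> where aff: "affine_weights b \<phi> \<psi> \<alpha> \<beta>" and pos: "\<alpha> > 0" "\<alpha> + \<beta> > 0"
    using affine_if_balanced[OF balanced_if_preserved ex] by blast
  have \<Psi>1: "\<Psi> 1 > 0" using psi_ext_pos[OF all, of 1] b_pos by simp
  have phi1: "\<phi> 1 > 0" "?\<phi> 1 > 0" using phi_1_pos[OF all] can.phi_1_pos[OF allc] by auto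
  let ?n = "2 * b + 1"
  have tot: "total ?n > 0" "can.total ?n > 0" using all allc by (auto simp: all_sizes_def)
  have "weight T / total ?n = can.weight T / can.total ?n" if "T \<in> bucket_trees b ?n" for T
    using that same[of ?n] pmf_random_tree[OF tot(1), of T] can.pmf_random_tree[OF tot(2), of T] by simp
  then have ratio: "weight T * can.total ?n = can.weight T * total ?n" if "T \<in> bucket_trees b ?n" for T
    using that tot by (simp add: field_simps)
  have ch: "chain b 0 2 1 \<in> bucket_trees b ?n" "star b [b, 1] \<in> bucket_trees b ?n"
    using chain_in_bucket_trees[of 1 b 2] star_in_bucket_trees[of b "[b, 1]"] b_pos
    by (simp_all add: mult_2)
  have w: "weight (chain b 0 2 1) = \<phi> 1 ^ 2 * \<Psi> 1" "weight (star b [b, 1]) = \<phi> 2 * \<phi> 0 * \<Psi> 1"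
    "can.weight (chain b 0 2 1) = ?\<phi> 1 ^ 2" "can.weight (star b [b, 1]) = ?\<phi> 2 * ?\<phi> 0"
    unfolding weight_chain can.weight_chain
    using \<Psi>c by (simp_all add: weight_star can.weight_star psi_ext_def[of _ _ _ b] numeral_2_eq_2)
  have "\<phi> 2 * \<phi> 0 * ?\<phi> 1 ^ 2 = ?\<phi> 2 * ?\<phi> 0 * \<phi> 1 ^ 2"
  proof -
    have "(\<phi> 1 ^ 2 * \<Psi> 1 * can.total ?n) * (?\<phi> 2 * ?\<phi> 0 * total ?n) =
        (?\<phi> 1 ^ 2 * total ?n) * (\<phi> 2 * \<phi> 0 * \<Psi> 1 * can.total ?n)"
      using ratio[OF ch(1)] ratio[OF ch(2)] unfolding w by simp
    then have "(\<Psi> 1 * can.total ?n * total ?n) * (?\<phi> 2 * ?\<phi> 0 * \<phi> 1 ^ 2) =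
        (\<Psi> 1 * can.total ?n * total ?n) * (\<phi> 2 * \<phi> 0 * ?\<phi> 1 ^ 2)"
      by (simp only: mult_ac)
    moreover have "\<Psi> 1 * can.total ?n * total ?n \<noteq> 0" using \<Psi>1 tot by simp
    ultimately show ?thesis by (simp only: mult_cancel_left) simp
  qed
  moreover have "2 * \<phi> 2 * \<phi> 0 * (\<alpha> * real b + \<beta>) = \<phi> 1 ^ 2 * (\<alpha> * real b)"
    using affine_phi_relation[OF aff \<Psi>1] .
  moreover have "2 * ?\<phi> 2 * ?\<phi> 0 * (?A * real b + ?B) = ?\<phi> 1 ^ 2 * (?A * real b)"
    using can.affine_phi_relation[OF affine_canonical] \<Psi>c by simp
  ultimately have "(\<phi> 1 ^ 2 * ?\<phi> 1 ^ 2) * ((\<alpha> * real b) * (?A * real b + ?B)) =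
      (\<phi> 1 ^ 2 * ?\<phi> 1 ^ 2) * ((?A * real b) * (\<alpha> * real b + \<beta>))"
    by algebra
  then have "(\<alpha> * real b) * (?A * real b + ?B) = (?A * real b) * (\<alpha> * real b + \<beta>)"
    using phi1 by simp
  then have "real b * (\<alpha> * ?B) = real b * (?A * \<beta>)"
    by (simp add: algebra_simps)
  then have slope_eq: "\<alpha> * ?B = ?A * \<beta>" using b_pos by simp
  \<comment> \<open>This rules out \<open>Ary 1\<close>: slope zero would force the offset to vanish
    too, against positivity of the line at n = 1.\<close>
  have "?A \<noteq> 0" using slope_eq pos(1) line[of 1] by auto
  then have "?A > 0" using admissible_slope_nonneg(1)[OF adm b_pos] by simp
  have "affine_weights b \<phi> \<psi> (\<alpha> / ?A * ?A) (\<alpha> / ?A * ?B)"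
    using aff slope_eq \<open>?A \<noteq> 0\<close> by simp
  then show ?thesis
    using modelled_if_affine[of b \<phi> \<psi> "\<alpha> / ?A" M] pos(1) \<open>?A > 0\<close> b_pos \<Psi>1 by simp
qed

end

text \<open>The last conjunct renders "respectively": the equivalence of the existential forms alone
  would allow different models for the weights and for the process.\<close>

theorem theorem1:
  fixes b :: nat and \<phi> \<psi> :: "nat \<Rightarrow> real"
  assumes "b \<ge> 1"
    and "\<And>k. \<phi> k \<ge> 0"
    and "\<phi> 0 > 0"
    and "\<exists>k\<ge>2. \<phi> k > 0"
    and "\<And>k. 1 \<le> k \<Longrightarrow> k < b \<Longrightarrow> \<psi> k \<ge> 0"
  shows "(combinatorial_model b \<phi> \<psi> \<longleftrightarrow> affine_ratio b \<phi> \<psi>) \<and>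
    (affine_ratio b \<phi> \<psi> \<longleftrightarrow> evolution_process b \<phi> \<psi>) \<and>
    (evolution_process b \<phi> \<psi> \<longleftrightarrow> growth_rule b \<phi> \<psi>) \<and>
    (growth_rule b \<phi> \<psi> \<longleftrightarrow> randomness_preserved b \<phi> \<psi>) \<and>
    (randomness_preserved b \<phi> \<psi> \<longleftrightarrow> balanced b \<phi> \<psi>) \<and>
    (\<forall>M. admissible b M \<longrightarrow> (modelled_by b \<phi> \<psi> M \<longleftrightarrow> generated_by b \<phi> \<psi> M))"
proof -
  interpret bucket_weights b \<phi> \<psi>
    by unfold_locales (use assms in auto)
  let ?affine = "\<exists>\<alpha> \<beta>. affine_weights b \<phi> \<psi> \<alpha> \<beta> \<and> \<alpha> > 0 \<and> \<alpha> + \<beta> > 0 \<and> \<Psi> 1 > 0"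
  have \<Psi>: "\<Psi> 1 > 0" if "all_sizes b \<phi> \<psi>"
    using psi_ext_pos[OF that, of 1] b_pos by simp
  have comb: "?affine" if "combinatorial_model b \<phi> \<psi>"
    using that generated_if_modelled(2)[OF _ _ assms(4)] by (auto simp: combinatorial_model_def)
  have equiv: "modelled_by b \<phi> \<psi> M \<longleftrightarrow> generated_by b \<phi> \<psi> M" if "admissible b M" for M
    using generated_if_modelled(1)[OF that _ assms(4)] modelled_if_generated[OF that _ assms(4)] by blast
  have evol: "?affine" if "evolution_process b \<phi> \<psi>"
    using that equiv comb by (auto simp: evolution_process_def combinatorial_model_def)
  have ratio: "?affine" if "affine_ratio b \<phi> \<psi>"
    using affine_if_affine_ratio[OF that assms(4)] \<Psi> that by (metis affine_ratio_def)
  have bal: "?affine" if "balanced b \<phi> \<psi>"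
    using affine_if_balanced[OF that assms(4)] \<Psi> that by (metis balanced_def)
  show ?thesis
    using comb evol ratio bal equiv affine_consequences preserved_if_growth_rule balanced_if_preserved by meson
qed

end
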